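(* Let $\sigma>0$. Suppose $(\bar x,\bar z)$ is a first-order KKT point of the penalty problem (PP) (for this value of $\sigma$) such that $Q(\bar x)^{1/2}A(\bar x)$ has full rank $m$, and let $(x^*,y^*,z^* )$ be a second-order necessary KKT point of (NP). Define $$\bar\sigma := \tfrac12\,\lambda_{\max}\!\left(P(x^* )\,Q(x^* )^{1/2}\,H_L(x^*,y^* )\,Q(x^* )^{1/2}\,P(x^* )\right).$$ Then: (a) if $\sigma > \|A(\bar x)^T Q(\bar x)\, Y_\sigma(\bar x)\|$, then $c(\bar x)=0$, and consequently $\bar x$ (with $\bar z$) is a first-order KKT point of (NP); (b) $p^T\nabla^2\phi_\sigma(x^* )\,p\ge 0$ for all $p\in \mathcal{C}_\phi(x^*,z^* )$ if and only if $\sigma\ge\bar\sigma$. Moreover, if $x^*$ is second-order sufficient, then (b) holds with strict inequalities: $p^T\nabla^2\phi_\sigma(x^* )\,p> 0$ for all nonzero $p\in \mathcal{C}_\phi(x^*,z^* )$ if and only if $\sigma>\bar\sigma$.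
   Context: Problem (NP): minimize $f(x)$ over $x\in\mathbb{R}^n$ subject to $c(x)=0$ and $\ell\le x\le u$, where $f:\mathbb{R}^n\to\mathbb{R}$, $c:\mathbb{R}^n\to\mathbb{R}^m$, $m\le n$, and the entries of $\ell,u$ may be infinite. Norms $\|\cdot\|$ are 2-norms, $\lambda_{\max}$ is the largest eigenvalue. Derivatives: $g(x)=\nabla f(x)$, $H(x)=\nabla^2 f(x)$, $H_i(x)=\nabla^2c_i(x)$, and $A(x)=[\nabla c_1(x)\ \cdots\ \nabla c_m(x)]\in\mathbb{R}^{n\times m}$. $H_L(x,y)=H(x)-\sum_{i=1}^m y_iH_i(x)$. Scaling matrix: $Q(x)=\mathrm{diag}(q_1(x_1),\dots,q_n(x_n))$, where, with a fixed positive vector $\omega$, $\omega<u-\ell$ (the paper uses $\omega_i=\min\{1,\tfrac12(u_i-\ell_i)\}$), $q_i(x_i)=1$ if $\ell_i=-\infty$ and $u_i=\infty$; $q_i(x_i)=\tfrac12(u_i-\ell_i)-\tfrac14\omega_i-\tfrac1{4\omega_i}(2x_i-u_i-\ell_i)^2$ if $|u_i+\ell_i-2x_i|\le\omega_i$; $q_i(x_i)=\min\{x_i-\ell_i,\,u_i-x_i\}$ otherwise. $Q(x)$ is nonnegative for $\ell\le x\le u$. Penalty function: for a parameter $\sigma$, $\phi_\sigma(x)=f(x)-c(x)^Ty_\sigma(x)$, where $y_\sigma(x)=\arg\min_{y\in\mathbb{R}^m}\ \tfrac12\|A(x)y-g(x)\|_{Q(x)}^2+\sigma c(x)^Ty$,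 $\|v\|_{Q}^2=v^TQv$. $Y_\sigma(x)=\nabla y_\sigma(x)\in\mathbb{R}^{n\times m}$ (the transpose of the Jacobian of $y_\sigma$). Penalty problem (PP): minimize $\phi_\sigma(x)$ subject to $\ell\le x\le u$. Projector: with $A_Q(x)=Q(x)^{1/2}A(x)$ of full rank $m$, $P(x)=A_Q(x)(A_Q(x)^TA_Q(x))^{-1}A_Q(x)^T$. KKT points: $(x^*,z^* )$ is a first-order KKT point of (NP) if for any $\sigma\ge0$ (if this holds for one $\sigma\ge 0$ it holds for all): $\ell\le x^*\le u$; $c(x^* )=0$; $\nabla\phi_\sigma(x^* )=z^*$; $z^*_j=0$ whenever $x^*_j\notin\{\ell_j,u_j\}$; $z_j^*\ge0$ if $x_j^*=\ell_j$; $z_j^*\le0$ if $x_j^*=u_j$. Then $y^*:=y_\sigma(x^* )$ is the associated multiplier. $(\bar x,\bar z)$ is a first-order KKT point of (PP) if the same conditions hold, for the given $\sigma$, with the condition $c=0$ omitted. Critical cones: $\mathcal{C}_\phi(x^*,z^* )=\{p: p_j=0 \text{ if } z_j^*\ne0;\ p_j\ge0\text{ if }x_j^*=\ell_j;\ p_j\le0\text{ if }x^*_j=u_j\}$ and $\mathcal{C}(x^*,z^* )=\{p\in\mathcal{C}_\phi(x^*,z^* ): A(x^* )^Tp=0\}$. A first-order KKT point $(x^*,z^* )$ of (NP) (with multiplier $y^*$) is second-order necessary if for any $\sigma\ge0$, $p^T\nabla^2\phi_\sigma(x^* )p\ge0$ for all $p\in\mathcal{C}(x^*,z^* )$; it is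 second-order sufficient if the inequality is strict (for $p\neq0$). Standing assumptions: (A1) $f$ and $c$ are three times continuously differentiable. (A2) LICQ holds at stationary points and at all $x$ with $\ell<x<u$, where LICQ at $x$ means that $\{\nabla c_i(x), e_j : i=1,\dots,m,\ x_j\in\{\ell_j,u_j\}\}$ is linearly independent ($e_j$ the $j$th unit vector). (A3) Strict complementarity: at a stationary point $(x^*,y^*,z^* )$, for every $j$ exactly one of $z^*_j$ and $\min\{x_j^*-\ell_j,u_j-x_j^*\}$ is zero. (A4) The problem is feasible and $\ell_j<u_j$ for all $j$. *)

theory Defs
  imports "HOL-Analysis.Analysis"
begin

section \<open>Derivatives and matrices\<close>

text \<open>
  A function is \<open>k\<close> times continuously differentiable on the whole space if all its iterated
  directional derivatives up to order \<open>k - 1\<close> are Frechet differentiable and those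
  of order \<open>k\<close> are continuous.
\<close>

primrec Ck :: "nat \<Rightarrow> ('a::euclidean_space \<Rightarrow> 'b::real_normed_vector) \<Rightarrow> bool" where
  "Ck 0 h = continuous_on UNIV h"
| "Ck (Suc k) h = ((\<forall>x. h differentiable (at x)) \<and>
     (\<forall>v. Ck k (\<lambda>x. frechet_derivative h (at x) v)))"

definition grad :: "(real^'n \<Rightarrow> real) \<Rightarrow> real^'n \<Rightarrow> real^'n" where
  "grad h x = (\<chi> j. frechet_derivative h (at x) (axis j 1))"

definition hess :: "(real^'n \<Rightarrow> real) \<Rightarrow> real^'n \<Rightarrow> real^'n^'n" where
  "hess h x = jacobian (grad h) (at x)"

text \<open>The type \<open>real^'m^'n\<close> is that of matrices with rows indexed by \<open>'n\<close> and columns by \<open>'m\<close>.\<close>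

definition Amat :: "(real^'n \<Rightarrow> real^'m) \<Rightarrow> real^'n \<Rightarrow> real^'m^'n" where
  "Amat c x = (\<chi> j i. grad (\<lambda>w. c w $ i) x $ j)"

definition hess_L :: "(real^'n \<Rightarrow> real) \<Rightarrow> (real^'n \<Rightarrow> real^'m) \<Rightarrow> real^'n \<Rightarrow> real^'m \<Rightarrow> real^'n^'n" where
  "hess_L f c x y = hess f x - (\<Sum>i\<in>UNIV. y $ i *\<^sub>R hess (\<lambda>w. c w $ i) x)"

definition diag :: "real^'n \<Rightarrow> real^'n^'n" where
  "diag d = (\<chi> i j. if i = j then d $ i else 0)"

definition lambda_max :: "real^'n^'n \<Rightarrow> real" where
  "lambda_max M = Max {k. \<exists>v. v \<noteq> 0 \<and> M *v v = k *\<^sub>R v}"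

text \<open>The spectral norm; the class norm on \<open>real^'n^'m\<close> is the Frobenius norm instead.\<close>

definition norm2 :: "real^'n^'m \<Rightarrow> real" where
  "norm2 M = onorm (\<lambda>v. M *v v)"


section \<open>The scaling matrix\<close>

text \<open>
  The bounds are extended reals. In the second case \<open>a + b - 2 t\<close> has a finite absolute
  value, so both bounds are finite; in the third at least one of them is, so the minimum is finite.
\<close>

definition qscale :: "ereal \<Rightarrow> ereal \<Rightarrow> real \<Rightarrow> real \<Rightarrow> real" where
  "qscale a b w t =
    (if a = -\<infinity> \<and> b = \<infinity> then 1
     else if \<bar>b + a - ereal (2 * t)\<bar> \<le> ereal w then
       (real_of_ereal b - real_of_ereal a) / 2 - w / 4
         - (2 * t - real_of_ereal b - real_of_ereal a)\<^sup>2 / (4 * w)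
     else real_of_ereal (min (ereal t - a) (b - ereal t)))"

definition qvec :: "ereal^'n \<Rightarrow> ereal^'n \<Rightarrow> real^'n \<Rightarrow> real^'n \<Rightarrow> real^'n" where
  "qvec l u \<omega> x = (\<chi> j. qscale (l $ j) (u $ j) (\<omega> $ j) (x $ j))"

definition Qmat :: "ereal^'n \<Rightarrow> ereal^'n \<Rightarrow> real^'n \<Rightarrow> real^'n \<Rightarrow> real^'n^'n" where
  "Qmat l u \<omega> x = diag (qvec l u \<omega> x)"

definition Qhalf :: "ereal^'n \<Rightarrow> ereal^'n \<Rightarrow> real^'n \<Rightarrow> real^'n \<Rightarrow> real^'n^'n" where
  "Qhalf l u \<omega> x = diag (\<chi> j. sqrt (qvec l u \<omega> x $ j))"

definition AQ :: "(real^'n \<Rightarrow> real^'m) \<Rightarrow> ereal^'n \<Rightarrow> ereal^'n \<Rightarrow> real^'n \<Rightarrow> real^'n \<Rightarrow> real^'m^'n" where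
  "AQ c l u \<omega> x = Qhalf l u \<omega> x ** Amat c x"

definition Pmat :: "(real^'n \<Rightarrow> real^'m) \<Rightarrow> ereal^'n \<Rightarrow> ereal^'n \<Rightarrow> real^'n \<Rightarrow> real^'n \<Rightarrow> real^'n^'n" where
  "Pmat c l u \<omega> x =
     AQ c l u \<omega> x ** matrix_inv (transpose (AQ c l u \<omega> x) ** AQ c l u \<omega> x)
       ** transpose (AQ c l u \<omega> x)"


section \<open>The penalty function\<close>

definition ls_obj :: "(real^'n \<Rightarrow> real) \<Rightarrow> (real^'n \<Rightarrow> real^'m) \<Rightarrow> ereal^'n \<Rightarrow> ereal^'n \<Rightarrow> real^'n
    \<Rightarrow> real \<Rightarrow> real^'n \<Rightarrow> real^'m \<Rightarrow> real" where
  "ls_obj f c l u \<omega> \<sigma> x y =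
     (let r = Amat c x *v y - grad f x
      in 1/2 * (r \<bullet> (Qmat l u \<omega> x *v r)) + \<sigma> * (c x \<bullet> y))"

text \<open>
  The minimiser exists and is unique near every point of the box at which \<open>AQ\<close> has full rank.
  Elsewhere the value is an arbitrary minimiser, or arbitrary if there is none.
\<close>

definition ysol :: "(real^'n \<Rightarrow> real) \<Rightarrow> (real^'n \<Rightarrow> real^'m) \<Rightarrow> ereal^'n \<Rightarrow> ereal^'n \<Rightarrow> real^'n
    \<Rightarrow> real \<Rightarrow> real^'n \<Rightarrow> real^'m" where
  "ysol f c l u \<omega> \<sigma> x = arg_min (ls_obj f c l u \<omega> \<sigma> x) (\<lambda>_. True)"

definition phi :: "(real^'n \<Rightarrow> real) \<Rightarrow> (real^'n \<Rightarrow> real^'m) \<Rightarrow> ereal^'n \<Rightarrow> ereal^'n \<Rightarrow> real^'n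
    \<Rightarrow> real \<Rightarrow> real^'n \<Rightarrow> real" where
  "phi f c l u \<omega> \<sigma> x = f x - c x \<bullet> ysol f c l u \<omega> \<sigma> x"

definition Ymat :: "(real^'n \<Rightarrow> real) \<Rightarrow> (real^'n \<Rightarrow> real^'m) \<Rightarrow> ereal^'n \<Rightarrow> ereal^'n \<Rightarrow> real^'n
    \<Rightarrow> real \<Rightarrow> real^'n \<Rightarrow> real^'m^'n" where
  "Ymat f c l u \<omega> \<sigma> x = transpose (jacobian (ysol f c l u \<omega> \<sigma>) (at x))"

definition hess_phi :: "(real^'n \<Rightarrow> real) \<Rightarrow> (real^'n \<Rightarrow> real^'m) \<Rightarrow> ereal^'n \<Rightarrow> ereal^'n \<Rightarrow> real^'n
    \<Rightarrow> real \<Rightarrow> real^'n \<Rightarrow> real^'n^'n" where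
  "hess_phi f c l u \<omega> \<sigma> x = hess (phi f c l u \<omega> \<sigma>) x"


section \<open>Optimality conditions\<close>

definition in_box :: "ereal^'n \<Rightarrow> ereal^'n \<Rightarrow> real^'n \<Rightarrow> bool" where
  "in_box l u x \<longleftrightarrow> (\<forall>j. l $ j \<le> ereal (x $ j) \<and> ereal (x $ j) \<le> u $ j)"

definition active :: "ereal^'n \<Rightarrow> ereal^'n \<Rightarrow> real^'n \<Rightarrow> 'n set" where
  "active l u x = {j. ereal (x $ j) \<in> {l $ j, u $ j}}"

definition kkt_PP :: "(real^'n \<Rightarrow> real) \<Rightarrow> (real^'n \<Rightarrow> real^'m) \<Rightarrow> ereal^'n \<Rightarrow> ereal^'n \<Rightarrow> real^'n
    \<Rightarrow> real \<Rightarrow> real^'n \<Rightarrow> real^'n \<Rightarrow> bool" where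
  "kkt_PP f c l u \<omega> \<sigma> x z \<longleftrightarrow>
     in_box l u x \<and>
     GDERIV (phi f c l u \<omega> \<sigma>) x :> z \<and>
     (\<forall>j. (j \<notin> active l u x \<longrightarrow> z $ j = 0) \<and>
          (ereal (x $ j) = l $ j \<longrightarrow> z $ j \<ge> 0) \<and>
          (ereal (x $ j) = u $ j \<longrightarrow> z $ j \<le> 0))"

definition kkt_NP :: "(real^'n \<Rightarrow> real) \<Rightarrow> (real^'n \<Rightarrow> real^'m) \<Rightarrow> ereal^'n \<Rightarrow> ereal^'n \<Rightarrow> real^'n
    \<Rightarrow> real^'n \<Rightarrow> real^'n \<Rightarrow> bool" where
  "kkt_NP f c l u \<omega> x z \<longleftrightarrow> c x = 0 \<and> (\<forall>\<sigma>\<ge>0. kkt_PP f c l u \<omega> \<sigma> x z)"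

text \<open>
  At a point with \<open>c x = 0\<close> the function minimised by \<open>ysol\<close> does not depend on \<open>\<sigma>\<close>,
  so the associated multiplier is the same for every \<open>\<sigma>\<close>.
\<close>

definition kkt_NP_mult :: "(real^'n \<Rightarrow> real) \<Rightarrow> (real^'n \<Rightarrow> real^'m) \<Rightarrow> ereal^'n \<Rightarrow> ereal^'n \<Rightarrow> real^'n
    \<Rightarrow> real^'n \<Rightarrow> real^'m \<Rightarrow> real^'n \<Rightarrow> bool" where
  "kkt_NP_mult f c l u \<omega> x y z \<longleftrightarrow>
     kkt_NP f c l u \<omega> x z \<and> (\<forall>\<sigma>\<ge>0. y = ysol f c l u \<omega> \<sigma> x)"

definition cone_phi :: "ereal^'n \<Rightarrow> ereal^'n \<Rightarrow> real^'n \<Rightarrow> real^'n \<Rightarrow> (real^'n) set" where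
  "cone_phi l u x z =
     {p. \<forall>j. (z $ j \<noteq> 0 \<longrightarrow> p $ j = 0) \<and>
             (ereal (x $ j) = l $ j \<longrightarrow> p $ j \<ge> 0) \<and>
             (ereal (x $ j) = u $ j \<longrightarrow> p $ j \<le> 0)}"

definition cone_NP :: "(real^'n \<Rightarrow> real^'m) \<Rightarrow> ereal^'n \<Rightarrow> ereal^'n \<Rightarrow> real^'n \<Rightarrow> real^'n \<Rightarrow> (real^'n) set" where
  "cone_NP c l u x z = {p \<in> cone_phi l u x z. transpose (Amat c x) *v p = 0}"

definition second_order_necessary :: "(real^'n \<Rightarrow> real) \<Rightarrow> (real^'n \<Rightarrow> real^'m) \<Rightarrow> ereal^'n \<Rightarrow> ereal^'n
    \<Rightarrow> real^'n \<Rightarrow> real^'n \<Rightarrow> real^'m \<Rightarrow> real^'n \<Rightarrow> bool" where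
  "second_order_necessary f c l u \<omega> x y z \<longleftrightarrow>
     kkt_NP_mult f c l u \<omega> x y z \<and>
     (\<forall>\<sigma>\<ge>0. \<forall>p\<in>cone_NP c l u x z. p \<bullet> (hess_phi f c l u \<omega> \<sigma> x *v p) \<ge> 0)"

definition second_order_sufficient :: "(real^'n \<Rightarrow> real) \<Rightarrow> (real^'n \<Rightarrow> real^'m) \<Rightarrow> ereal^'n \<Rightarrow> ereal^'n
    \<Rightarrow> real^'n \<Rightarrow> real^'n \<Rightarrow> real^'m \<Rightarrow> real^'n \<Rightarrow> bool" where
  "second_order_sufficient f c l u \<omega> x y z \<longleftrightarrow>
     kkt_NP_mult f c l u \<omega> x y z \<and>
     (\<forall>\<sigma>\<ge>0. \<forall>p\<in>cone_NP c l u x z. p \<noteq> 0 \<longrightarrow> p \<bullet> (hess_phi f c l u \<omega> \<sigma> x *v p) > 0)"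

definition sigma_bar :: "(real^'n \<Rightarrow> real) \<Rightarrow> (real^'n \<Rightarrow> real^'m) \<Rightarrow> ereal^'n \<Rightarrow> ereal^'n
    \<Rightarrow> real^'n \<Rightarrow> real^'n \<Rightarrow> real^'m \<Rightarrow> real" where
  "sigma_bar f c l u \<omega> x y =
     1/2 * lambda_max (Pmat c l u \<omega> x ** Qhalf l u \<omega> x ** hess_L f c x y
                         ** Qhalf l u \<omega> x ** Pmat c l u \<omega> x)"


section \<open>Constraint qualification\<close>

definition constraint_normal :: "(real^'n \<Rightarrow> real^'m) \<Rightarrow> real^'n \<Rightarrow> 'm + 'n \<Rightarrow> real^'n" where
  "constraint_normal c x k = (case k of Inl i \<Rightarrow> grad (\<lambda>w. c w $ i) x | Inr j \<Rightarrow> axis j 1)"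

text \<open>
  Linear independence of an indexed family: \<open>independent\<close> is about sets, so injectivity is
  needed to rule out repeated members.
\<close>

definition licq :: "(real^'n \<Rightarrow> real^'m) \<Rightarrow> ereal^'n \<Rightarrow> ereal^'n \<Rightarrow> real^'n \<Rightarrow> bool" where
  "licq c l u x \<longleftrightarrow>
     (let K = range Inl \<union> Inr ` active l u x
      in inj_on (constraint_normal c x) K \<and> independent (constraint_normal c x ` K))"

end

theory Submission
  imports Defs
begin

text \<open>
  Write \<open>A\<close>, \<open>g\<close> for the gradients of the constraints and of the objective, \<open>y\<close> for the multipliers
  \<open>ysol\<close> and \<open>r = g - A y\<close> for their residual. All conclusions come from the normal equations
  \<open>A\<^sup>T Q r = \<sigma> c\<close> of the least squares problem behind \<open>y\<close>, read once as they stand and once after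
  differentiation.

  The normal equations characterise \<open>y\<close> wherever \<open>A\<^sup>T Q A\<close> is positive definite. This is an open set
  (\<open>open_regular\<close>), it contains every point of the box at which \<open>Q\<^sup>1\<^sup>/\<^sup>2 A\<close> is injective (\<open>regularI\<close>),
  and by Cramer's rule \<open>y\<close> is continuously differentiable on it (\<open>C1_ysol\<close>). Hence
  \<open>\<nabla>\<phi> = r - Y c\<close> there (\<open>GDERIV_phi\<close>).

  Feasibility. At a first-order point of the penalty problem \<open>z = r - Y c\<close>, and \<open>Q z = 0\<close> because
  \<open>Q\<close> vanishes at active bounds and \<open>z\<close> at inactive ones. Multiplication with \<open>A\<^sup>T Q\<close> turns this into
  \<open>\<sigma> c = A\<^sup>T Q Y c\<close>, which forces \<open>c = 0\<close> if \<open>\<sigma>\<close> exceeds the norm of \<open>A\<^sup>T Q Y\<close>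
  (\<open>kkt_PP_feasible\<close>). Where \<open>c = 0\<close> neither \<open>y\<close> nor \<open>\<nabla>\<phi> = r\<close> depends on \<open>\<sigma>\<close>, so the point is
  then a first-order point of the original problem.

  Second-order conditions. The scaling function is continuously differentiable but in general
  not twice so, which leaves \<open>Y\<close> merely continuous. At a feasible point this is
  enough for \<open>Y c\<close> to be differentiable, and the Hessian of \<open>\<phi>\<close> is \<open>H\<^sub>L - A Y\<^sup>T - Y A\<^sup>T\<close> (\<open>hess_phi_mult_vec\<close>). By strict complementarity the
  critical cone of the penalty problem consists of the vectors that vanish at the active bounds,
  that is, of the vectors \<open>p = Q\<^sup>1\<^sup>/\<^sup>2 v\<close>. Along such \<open>p\<close> the derivative of the normal equations is
  \<open>A\<^sup>T Q (H\<^sub>L p - A Y\<^sup>T p) = \<sigma> A\<^sup>T p\<close> (\<open>normal_equations_derivative\<close>), so \<open>Y\<^sup>T p\<close> can be eliminated: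
  with \<open>B = Q\<^sup>1\<^sup>/\<^sup>2 H\<^sub>L Q\<^sup>1\<^sup>/\<^sup>2\<close> and the projector \<open>P\<close> onto the range of \<open>Q\<^sup>1\<^sup>/\<^sup>2 A\<close>, the quadratic form becomes
  \<open>(v - P v) \<bullet> B (v - P v) - P v \<bullet> B P v + 2 \<sigma> (P v \<bullet> P v)\<close> (\<open>quadratic_form_split\<close>).
  The first term is the form on the critical cone of the original problem, whose sign is given by
  hypothesis. As \<open>\<sigma>\<close> is positive, the other two together are nonnegative for all \<open>v\<close> exactly if
  \<open>2 \<sigma>\<close> bounds the Rayleigh quotients of \<open>P B P\<close>, that is, its largest eigenvalue
  (\<open>split_form_nonneg_iff\<close>, \<open>split_form_pos_iff\<close>).
\<close>

section \<open>Continuously differentiable real functions\<close>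

text \<open>
  Working with gradients keeps everything real-valued, so that the existing calculus of \<open>GDERIV\<close>
  yields the closure properties directly.
\<close>

definition C1_on :: "'a::real_inner set \<Rightarrow> ('a \<Rightarrow> real) \<Rightarrow> bool" where
  "C1_on S h \<longleftrightarrow> (\<exists>G. (\<forall>x\<in>S. GDERIV h x :> G x) \<and> continuous_on S G)"

lemma GDERIV_unique:
  assumes "GDERIV h x :> a" "GDERIV h x :> b"
  shows "a = b"
proof -
  have "(\<lambda>v. v \<bullet> a) = (\<lambda>v. v \<bullet> b)"
    using assms unfolding gderiv_def by (rule has_derivative_unique)
  then have "(a - b) \<bullet> a = (a - b) \<bullet> b" by metis
  then have "(a - b) \<bullet> (a - b) = 0" by (simp add: inner_diff_right)
  then show ?thesis by simp
qed

lemma C1_on_imp_continuous_on: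
  assumes "C1_on S h" shows "continuous_on S h"
proof -
  obtain G where "\<And>x. x \<in> S \<Longrightarrow> GDERIV h x :> G x"
    using assms unfolding C1_on_def by blast
  then have "(h has_derivative (\<lambda>v. v \<bullet> G x)) (at x within S)" if "x \<in> S" for x
    using that unfolding gderiv_def by (blast intro: has_derivative_at_withinI)
  then show ?thesis by (rule has_derivative_continuous_on)
qed

lemma C1_on_subset: "C1_on S h \<Longrightarrow> T \<subseteq> S \<Longrightarrow> C1_on T h"
  unfolding C1_on_def by (blast intro: continuous_on_subset)

lemma C1_on_const: "C1_on S (\<lambda>x. k)"
  unfolding C1_on_def by (rule exI[of _ "\<lambda>x. 0"]) (auto simp: GDERIV_const)

lemma C1_on_add:
  assumes "C1_on S h" "C1_on S k" shows "C1_on S (\<lambda>x. h x + k x)"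
proof -
  obtain G K where "\<forall>x\<in>S. GDERIV h x :> G x" "continuous_on S G"
    "\<forall>x\<in>S. GDERIV k x :> K x" "continuous_on S K"
    using assms unfolding C1_on_def by blast
  then show ?thesis
    unfolding C1_on_def by (intro exI[of _ "\<lambda>x. G x + K x"]) (simp add: GDERIV_add continuous_on_add)
qed

lemma C1_on_diff:
  assumes "C1_on S h" "C1_on S k" shows "C1_on S (\<lambda>x. h x - k x)"
proof -
  obtain G K where "\<forall>x\<in>S. GDERIV h x :> G x" "continuous_on S G"
    "\<forall>x\<in>S. GDERIV k x :> K x" "continuous_on S K"
    using assms unfolding C1_on_def by blast
  then show ?thesis
    unfolding C1_on_def by (intro exI[of _ "\<lambda>x. G x - K x"]) (simp add: GDERIV_diff continuous_on_diff)
qed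

lemma C1_on_mult:
  assumes "C1_on S h" "C1_on S k" shows "C1_on S (\<lambda>x. h x * k x)"
proof -
  obtain G where G: "\<And>x. x \<in> S \<Longrightarrow> GDERIV h x :> G x" "continuous_on S G"
    using assms(1) unfolding C1_on_def by blast
  obtain K where K: "\<And>x. x \<in> S \<Longrightarrow> GDERIV k x :> K x" "continuous_on S K"
    using assms(2) unfolding C1_on_def by blast
  have "continuous_on S (\<lambda>x. h x *\<^sub>R K x + k x *\<^sub>R G x)"
    using G(2) K(2) assms[THEN C1_on_imp_continuous_on] by (intro continuous_intros)
  moreover have "\<forall>x\<in>S. GDERIV (\<lambda>x. h x * k x) x :> h x *\<^sub>R K x + k x *\<^sub>R G x"
    by (intro ballI GDERIV_mult G K)
  ultimately show ?thesis
    unfolding C1_on_def by (intro exI[of _ "\<lambda>x. h x *\<^sub>R K x + k x *\<^sub>R G x"] conjI)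
qed

lemma C1_on_divide:
  assumes "C1_on S h" "C1_on S k" "\<And>x. x \<in> S \<Longrightarrow> k x \<noteq> 0"
  shows "C1_on S (\<lambda>x. h x / k x)"
proof -
  obtain K where K: "\<And>x. x \<in> S \<Longrightarrow> GDERIV k x :> K x" "continuous_on S K"
    using assms(2) unfolding C1_on_def by blast
  have "continuous_on S (\<lambda>x. - (inverse (k x))\<^sup>2 *\<^sub>R K x)"
    using K(2) C1_on_imp_continuous_on[OF assms(2)] assms(3) by (intro continuous_intros) auto
  moreover have "\<forall>x\<in>S. GDERIV (\<lambda>x. inverse (k x)) x :> - (inverse (k x))\<^sup>2 *\<^sub>R K x"
    by (intro ballI GDERIV_inverse K assms)
  ultimately have "C1_on S (\<lambda>x. inverse (k x))"
    unfolding C1_on_def by (intro exI[of _ "\<lambda>x. - (inverse (k x))\<^sup>2 *\<^sub>R K x"] conjI)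
  from C1_on_mult[OF assms(1) this] show ?thesis by (simp add: divide_inverse)
qed

lemma C1_on_sum:
  assumes "\<And>i. i \<in> I \<Longrightarrow> C1_on S (h i)" shows "C1_on S (\<lambda>x. \<Sum>i\<in>I. h i x)"
  using assms by (induction I rule: infinite_finite_induct) (auto intro: C1_on_add C1_on_const)

lemma C1_on_prod:
  assumes "\<And>i. i \<in> I \<Longrightarrow> C1_on S (h i)" shows "C1_on S (\<lambda>x. \<Prod>i\<in>I. h i x)"
  using assms by (induction I rule: infinite_finite_induct) (auto intro: C1_on_mult C1_on_const)

text \<open>
  The determinant is a polynomial in the entries. Through Cramer's rule this makes solutions of
  linear systems continuously differentiable without a derivative of matrix inversion.
\<close>

lemma C1_on_det:
  fixes M :: "'a::real_inner \<Rightarrow> real^'m^'m"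
  assumes "\<And>i j. C1_on S (\<lambda>x. M x $ i $ j)"
  shows "C1_on S (\<lambda>x. det (M x))"
  unfolding det_def by (intro C1_on_sum C1_on_mult C1_on_prod C1_on_const assms)

lemma C1_on_cong:
  assumes "C1_on S h" "open S" "\<And>x. x \<in> S \<Longrightarrow> k x = h x"
  shows "C1_on S k"
proof -
  obtain G where G: "\<And>x. x \<in> S \<Longrightarrow> GDERIV h x :> G x" "continuous_on S G"
    using assms(1) unfolding C1_on_def by blast
  have "GDERIV k x :> G x" if "x \<in> S" for x
    using G(1)[OF that] assms(2,3) that unfolding gderiv_def
    by (metis has_derivative_transform_within_open)
  then show ?thesis using G(2) unfolding C1_on_def by blast
qed

lemma C1_on_component:
  fixes q q' :: "real \<Rightarrow> real"
  assumes "\<And>t. (q has_real_derivative q' t) (at t)" "continuous_on UNIV q'"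
  shows "C1_on S (\<lambda>x::real^'n. q (x $ j))"
proof -
  have "GDERIV (\<lambda>x::real^'n. x $ j) x :> axis j 1" for x
    unfolding gderiv_def inner_axis
    by (simp add: bounded_linear_imp_has_derivative bounded_linear_vec_nth)
  from GDERIV_DERIV_compose[OF this assms(1)]
  have "GDERIV (\<lambda>x::real^'n. q (x $ j)) x :> q' (x $ j) *\<^sub>R axis j 1" for x .
  moreover have "continuous_on S (\<lambda>x::real^'n. q' (x $ j) *\<^sub>R (axis j 1 :: real^'n))"
    by (intro continuous_intros continuous_on_compose2[OF assms(2)]) auto
  ultimately show ?thesis
    unfolding C1_on_def by (intro exI[of _ "\<lambda>x. q' (x $ j) *\<^sub>R axis j 1"]) auto
qed

text \<open>
  A product rule for a factor \<open>G\<close> that is merely continuous: the term \<open>h w *\<^sub>R (G w - G x)\<close> is of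
  smaller order than \<open>w - x\<close>, because \<open>h\<close> vanishes at \<open>x\<close> and hence \<open>h w\<close> is of order \<open>w - x\<close>.
\<close>

lemma has_derivative_scaleR_at_zero:
  fixes h :: "'a::real_normed_vector \<Rightarrow> real" and G :: "'a \<Rightarrow> 'b::real_normed_vector"
  assumes h: "(h has_derivative h') (at x)" and zero: "h x = 0" and G: "isCont G x"
  shows "((\<lambda>w. h w *\<^sub>R G w) has_derivative (\<lambda>p. h' p *\<^sub>R G x)) (at x)"
proof -
  have lin: "bounded_linear h'" using h by (rule has_derivative_bounded_linear)
  then obtain K where K: "\<And>p. norm (h' p) \<le> norm p * K"
    using bounded_linear.bounded by blast
  define e where "e w = norm (h w - h' (w - x)) / norm (w - x)" for w
  have e: "(e \<longlongrightarrow> 0) (at x)"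
    using h zero unfolding has_derivative_iff_norm e_def by auto
  have bound: "norm (norm (h w *\<^sub>R G w - h x *\<^sub>R G x - h' (w - x) *\<^sub>R G x) / norm (w - x))
      \<le> (e w + K) * norm (G w - G x) + e w * norm (G x)" if "w \<noteq> x" for w
  proof -
    have pos: "0 < norm (w - x)" using that by simp
    have "h w *\<^sub>R G w - h x *\<^sub>R G x - h' (w - x) *\<^sub>R G x
        = (h w - h' (w - x)) *\<^sub>R (G w - G x) + h' (w - x) *\<^sub>R (G w - G x)
          + (h w - h' (w - x)) *\<^sub>R G x"
      using zero by (simp add: algebra_simps)
    also have "norm \<dots> \<le> norm (h w - h' (w - x)) * norm (G w - G x)
        + norm (w - x) * K * norm (G w - G x) + norm (h w - h' (w - x)) * norm (G x)"
      by (intro norm_triangle_le add_mono mult_right_mono)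
         (auto intro: mult_right_mono K simp: K[simplified])
    finally show ?thesis
      using pos unfolding e_def by (simp add: field_simps)
  qed
  have "((\<lambda>w. (e w + K) * norm (G w - G x) + e w * norm (G x)) \<longlongrightarrow>
      (0 + K) * norm (G x - G x) + 0 * norm (G x)) (at x)"
    using G unfolding isCont_def by (intro tendsto_intros e)
  then have lim: "((\<lambda>w. (e w + K) * norm (G w - G x) + e w * norm (G x)) \<longlongrightarrow> 0) (at x)"
    by simp
  have "((\<lambda>w. norm (h w *\<^sub>R G w - h x *\<^sub>R G x - h' (w - x) *\<^sub>R G x) / norm (w - x)) \<longlongrightarrow> 0) (at x)"
    by (rule Lim_null_comparison[OF _ lim]) (use bound in \<open>auto simp: eventually_at_filter\<close>)
  moreover have "bounded_linear (\<lambda>p. h' p *\<^sub>R G x)"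
    using lin by (rule bounded_linear_compose[OF bounded_linear_scaleR_left])
  ultimately show ?thesis unfolding has_derivative_iff_norm by simp
qed

section \<open>Symmetry of second derivatives\<close>

text \<open>
  The mean value theorem, applied first in direction \<open>v\<close> to the increment in direction \<open>w\<close>, and
  then in direction \<open>w\<close> to the directional derivative along \<open>v\<close>.
\<close>

lemma second_difference_mean_value:
  fixes h :: "'a::real_normed_vector \<Rightarrow> real"
  assumes h: "\<And>x. h differentiable (at x)"
    and hv: "\<And>x. (\<lambda>x. frechet_derivative h (at x) v) differentiable (at x)"
    and s: "0 < s"
  shows "\<exists>a b. 0 < a \<and> a < s \<and> 0 < b \<and> b < s \<and>
    h (x + s *\<^sub>R v + s *\<^sub>R w) - h (x + s *\<^sub>R v) - h (x + s *\<^sub>R w) + h x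
      = s\<^sup>2 * frechet_derivative (\<lambda>x. frechet_derivative h (at x) v) (at (x + a *\<^sub>R v + b *\<^sub>R w)) w"
proof -
  have along: "((\<lambda>t. k (z + t *\<^sub>R d)) has_real_derivative
      frechet_derivative k (at (z + t *\<^sub>R d)) d) (at t)"
    if "\<And>x. k differentiable (at x)" for k :: "'a \<Rightarrow> real" and z d t
  proof -
    have 1: "(k has_derivative frechet_derivative k (at (z + t *\<^sub>R d))) (at (z + t *\<^sub>R d))"
      using that frechet_derivative_works by blast
    have 2: "((\<lambda>t. z + t *\<^sub>R d) has_derivative (\<lambda>r. r *\<^sub>R d)) (at t)"
      by (auto intro!: derivative_eq_intros)
    have "((\<lambda>t. k (z + t *\<^sub>R d)) has_derivative
        (\<lambda>r. frechet_derivative k (at (z + t *\<^sub>R d)) (r *\<^sub>R d))) (at t)"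
      using has_derivative_compose[OF 2 1] .
    moreover have "frechet_derivative k (at (z + t *\<^sub>R d)) (r *\<^sub>R d)
        = frechet_derivative k (at (z + t *\<^sub>R d)) d * r" for r
      using linear_frechet_derivative[OF that, of "z + t *\<^sub>R d"]
      by (simp add: linear_cmul)
    ultimately show ?thesis unfolding has_field_derivative_def by simp
  qed
  let ?D = "\<lambda>x. frechet_derivative h (at x) v"
  have "((\<lambda>t. h ((x + s *\<^sub>R w) + t *\<^sub>R v) - h (x + t *\<^sub>R v)) has_real_derivative
      ?D ((x + s *\<^sub>R w) + t *\<^sub>R v) - ?D (x + t *\<^sub>R v)) (at t)" for t
    by (intro DERIV_diff along h)
  from MVT2[OF s, OF this] obtain a where a: "0 < a" "a < s"
    "h ((x + s *\<^sub>R w) + s *\<^sub>R v) - h (x + s *\<^sub>R v) - (h ((x + s *\<^sub>R w) + 0 *\<^sub>R v) - h (x + 0 *\<^sub>R v))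
      = (s - 0) * (?D ((x + s *\<^sub>R w) + a *\<^sub>R v) - ?D (x + a *\<^sub>R v))" by blast
  have "((\<lambda>t. ?D ((x + a *\<^sub>R v) + t *\<^sub>R w)) has_real_derivative
      frechet_derivative ?D (at ((x + a *\<^sub>R v) + t *\<^sub>R w)) w) (at t)" for t
    by (intro along hv)
  from MVT2[OF s, OF this] obtain b where b: "0 < b" "b < s"
    "?D ((x + a *\<^sub>R v) + s *\<^sub>R w) - ?D ((x + a *\<^sub>R v) + 0 *\<^sub>R w)
      = (s - 0) * frechet_derivative ?D (at ((x + a *\<^sub>R v) + b *\<^sub>R w)) w" by blast
  have "h (x + s *\<^sub>R v + s *\<^sub>R w) - h (x + s *\<^sub>R v) - h (x + s *\<^sub>R w) + h x
      = s\<^sup>2 * frechet_derivative ?D (at (x + a *\<^sub>R v + b *\<^sub>R w)) w"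
    using a(3) b(3) by (simp add: algebra_simps power2_eq_square)
  then show ?thesis using a(1,2) b(1,2) by blast
qed

text \<open>
  The second difference is symmetric in \<open>v\<close> and \<open>w\<close>. By the mean value form above it equals \<open>s\<^sup>2\<close> times
  either mixed derivative at some point close to \<open>x\<close>, so by continuity the two mixed derivatives
  at \<open>x\<close> cannot differ.
\<close>

lemma symmetric_second_derivative:
  fixes h :: "'a::real_normed_vector \<Rightarrow> real"
  assumes h: "\<And>x. h differentiable (at x)"
    and hv: "\<And>v x. (\<lambda>x. frechet_derivative h (at x) v) differentiable (at x)"
    and cont: "\<And>v w. continuous_on UNIV
      (\<lambda>x. frechet_derivative (\<lambda>x. frechet_derivative h (at x) v) (at x) w)"
  shows "frechet_derivative (\<lambda>x. frechet_derivative h (at x) v) (at x) w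
       = frechet_derivative (\<lambda>x. frechet_derivative h (at x) w) (at x) v"
proof (rule ccontr)
  define F where "F v w x = frechet_derivative (\<lambda>x. frechet_derivative h (at x) v) (at x) w" for v w x
  assume "\<not> ?thesis"
  then have ne: "F v w x \<noteq> F w v x" by (simp add: F_def)
  define e where "e = \<bar>F v w x - F w v x\<bar> / 2"
  have e: "0 < e" using ne by (simp add: e_def)
  have near: "\<exists>d>0. \<forall>y. dist y x < d \<longrightarrow> dist (F a b y) (F a b x) < e" for a b
    using cont[of a b] e unfolding F_def continuous_on_iff by (metis UNIV_I)
  obtain d1 where d1: "d1 > 0" "\<And>y. dist y x < d1 \<Longrightarrow> dist (F v w y) (F v w x) < e"
    using near by blast
  obtain d2 where d2: "d2 > 0" "\<And>y. dist y x < d2 \<Longrightarrow> dist (F w v y) (F w v x) < e"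
    using near by blast
  define d where "d = min d1 d2"
  \<comment> \<open>A step so short that the whole parallelogram with sides \<open>s v\<close> and \<open>s w\<close> lies within \<open>d\<close> of \<open>x\<close>.\<close>
  define s where "s = d / (2 * (norm v + norm w + 1))"
  have pos: "0 < norm v + norm w + 1" by (smt (verit) norm_ge_zero)
  have s: "0 < s" using d1 d2 pos by (simp add: s_def d_def)
  have close: "dist (x + a *\<^sub>R v + b *\<^sub>R w) x < d" if "0 < a" "a < s" "0 < b" "b < s" for a b
  proof -
    have "dist (x + a *\<^sub>R v + b *\<^sub>R w) x = norm (a *\<^sub>R v + b *\<^sub>R w)" by (simp add: dist_norm)
    also have "\<dots> \<le> a * norm v + b * norm w"
      using that by (intro norm_triangle_le) simp
    also have "\<dots> \<le> s * norm v + s * norm w"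
      using that by (intro add_mono mult_right_mono) auto
    also have "\<dots> \<le> s * (norm v + norm w + 1)" using s by (simp add: algebra_simps)
    also have "\<dots> = d / 2" using pos unfolding s_def by (simp del: add_pos_pos add: divide_simps)
    also have "\<dots> < d" using d1(1) d2(1) by (simp add: d_def min_def)
    finally show ?thesis .
  qed
  obtain a b where ab: "0 < a" "a < s" "0 < b" "b < s"
    "h (x + s *\<^sub>R v + s *\<^sub>R w) - h (x + s *\<^sub>R v) - h (x + s *\<^sub>R w) + h x
      = s\<^sup>2 * F v w (x + a *\<^sub>R v + b *\<^sub>R w)"
    using second_difference_mean_value[OF h hv s] unfolding F_def by blast
  obtain a' b' where ab': "0 < a'" "a' < s" "0 < b'" "b' < s"
    "h (x + s *\<^sub>R w + s *\<^sub>R v) - h (x + s *\<^sub>R w) - h (x + s *\<^sub>R v) + h x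
      = s\<^sup>2 * F w v (x + a' *\<^sub>R w + b' *\<^sub>R v)"
    using second_difference_mean_value[OF h hv s] unfolding F_def by blast
  have swap: "x + s *\<^sub>R w + s *\<^sub>R v = x + s *\<^sub>R v + s *\<^sub>R w" by simp
  have "s\<^sup>2 * F v w (x + a *\<^sub>R v + b *\<^sub>R w) = s\<^sup>2 * F w v (x + a' *\<^sub>R w + b' *\<^sub>R v)"
    using ab(5) ab'(5)[unfolded swap] by linarith
  then have eq: "F v w (x + a *\<^sub>R v + b *\<^sub>R w) = F w v (x + b' *\<^sub>R v + a' *\<^sub>R w)"
    using s by (simp add: add_ac)
  have "dist (F v w (x + a *\<^sub>R v + b *\<^sub>R w)) (F v w x) < e"
    using close[OF ab(1-4)] by (intro d1) (simp add: d_def)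
  moreover have "dist (F w v (x + b' *\<^sub>R v + a' *\<^sub>R w)) (F w v x) < e"
    using close[OF ab'(3,4,1,2)] by (intro d2) (simp add: d_def)
  ultimately show False using eq unfolding e_def dist_real_def by (auto simp: abs_if split: if_splits)
qed

section \<open>Gradients and Hessians of smooth functions\<close>

lemma Ck_Suc_imp_Ck: "Ck (Suc k) h \<Longrightarrow> Ck k h"
proof (induction k arbitrary: h)
  case 0
  then show ?case
    by (simp add: continuous_at_imp_continuous_on differentiable_imp_continuous_within)
next
  case (Suc k)
  from Suc.prems have d: "\<forall>x. h differentiable (at x)"
    and D: "\<And>v. Ck (Suc k) (\<lambda>x. frechet_derivative h (at x) v)"
    by (simp_all only: Ck.simps) blast+
  show ?case unfolding Ck.simps(2)[of k] using d Suc.IH[OF D] by blast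
qed

lemma Ck_component:
  fixes c :: "'a::euclidean_space \<Rightarrow> real^'m"
  assumes "Ck k c" shows "Ck k (\<lambda>x. c x $ i)"
  using assms
proof (induction k arbitrary: c)
  case 0
  then show ?case by (simp add: continuous_on_component)
next
  case (Suc k)
  have d: "(c has_derivative frechet_derivative c (at x)) (at x)" for x
    using Suc.prems by (simp add: frechet_derivative_works)
  have di: "((\<lambda>x. c x $ i) has_derivative (\<lambda>v. frechet_derivative c (at x) v $ i)) (at x)" for x
    using bounded_linear.has_derivative[OF bounded_linear_vec_nth d] .
  have "frechet_derivative (\<lambda>x. c x $ i) (at x) = (\<lambda>v. frechet_derivative c (at x) v $ i)" for x
    using frechet_derivative_at[OF di] by simp
  moreover have "Ck k (\<lambda>x. frechet_derivative c (at x) v $ i)" for v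
    using Suc.prems by (intro Suc.IH) simp
  ultimately show ?case using di by (auto simp: differentiable_def)
qed

lemma GDERIV_grad:
  fixes h :: "real^'n \<Rightarrow> real"
  assumes "h differentiable (at x)" shows "GDERIV h x :> grad h x"
proof -
  let ?D = "frechet_derivative h (at x)"
  have D: "(h has_derivative ?D) (at x)" using assms frechet_derivative_works by blast
  interpret bounded_linear ?D using D by (rule has_derivative_bounded_linear)
  have eq: "?D = (\<lambda>v. v \<bullet> grad h x)"
  proof
    fix v
    have "?D v = ?D (\<Sum>j\<in>UNIV. v $ j *\<^sub>R axis j 1)"
      using basis_expansion[of v] by (simp add: scalar_mult_eq_scaleR)
    also have "\<dots> = v \<bullet> grad h x"
      by (simp add: sum scaleR inner_vec_def grad_def)
    finally show "?D v = v \<bullet> grad h x" .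
  qed
  show ?thesis unfolding gderiv_def using D by (simp only: eq)
qed

lemma grad_eqI:
  fixes h :: "real^'n \<Rightarrow> real"
  assumes "GDERIV h x :> D" shows "grad h x = D"
proof -
  have "h differentiable (at x)" using assms unfolding gderiv_def differentiable_def by blast
  then show ?thesis by (rule GDERIV_unique[OF GDERIV_grad assms])
qed

lemma Ck_1_imp_C1_on:
  fixes h :: "real^'n \<Rightarrow> real"
  assumes "Ck (Suc 0) h" shows "C1_on UNIV h"
proof -
  have d: "h differentiable (at x)" for x using assms unfolding Ck.simps by blast
  have "continuous_on UNIV (\<lambda>x. frechet_derivative h (at x) v)" for v
    using assms unfolding Ck.simps by blast
  then have "continuous_on UNIV (grad h)"
    unfolding grad_def[abs_def] by (rule continuous_on_vec_lambda)
  then show ?thesis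
    unfolding C1_on_def using GDERIV_grad[OF d] by (intro exI[of _ "grad h"]) simp
qed

lemma Ck_2_imp_C1_on_grad:
  fixes h :: "real^'n \<Rightarrow> real"
  assumes "Ck (Suc (Suc 0)) h" shows "C1_on UNIV (\<lambda>x. grad h x $ j)"
proof -
  have "Ck (Suc 0) (\<lambda>x. frechet_derivative h (at x) (axis j 1))"
    using assms unfolding Ck.simps(2)[of "Suc 0"] by blast
  moreover have "(\<lambda>x. grad h x $ j) = (\<lambda>x. frechet_derivative h (at x) (axis j 1))"
    by (simp add: grad_def)
  ultimately show ?thesis by (simp only: Ck_1_imp_C1_on)
qed

lemma differentiable_vecI:
  fixes h :: "'a::euclidean_space \<Rightarrow> real^'n"
  assumes "\<And>j. (\<lambda>x. h x $ j) differentiable (at x)" shows "h differentiable (at x)"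
  using assms unfolding differentiable_componentwise_within[of h]
  by (auto simp: Basis_vec_def inner_axis)

lemma has_derivative_grad:
  fixes h :: "real^'n \<Rightarrow> real"
  assumes "\<And>j. (\<lambda>x. grad h x $ j) differentiable (at x)"
  shows "(grad h has_derivative (\<lambda>p. hess h x *v p)) (at x)"
proof -
  have "grad h differentiable (at x)" using assms by (rule differentiable_vecI)
  then show ?thesis by (simp add: hess_def jacobian_works[symmetric])
qed

lemma C1_on_differentiable:
  assumes "C1_on S h" "x \<in> S" shows "h differentiable (at x)"
  using assms unfolding C1_on_def gderiv_def differentiable_def by blast

lemma C1_on_GDERIV:
  fixes h :: "real^'n \<Rightarrow> real"
  assumes "C1_on S h" "x \<in> S" shows "GDERIV h x :> grad h x"
  using C1_on_differentiable[OF assms] by (rule GDERIV_grad)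

lemma C1_on_continuous_grad:
  fixes h :: "real^'n \<Rightarrow> real"
  assumes "C1_on S h" shows "continuous_on S (grad h)"
proof -
  obtain G where G: "\<And>x. x \<in> S \<Longrightarrow> GDERIV h x :> G x" "continuous_on S G"
    using assms unfolding C1_on_def by blast
  have "grad h x = G x" if "x \<in> S" for x using G(1)[OF that] by (rule grad_eqI)
  then show ?thesis using G(2) by (simp cong: continuous_on_cong)
qed

lemma transpose_hess:
  fixes h :: "real^'n \<Rightarrow> real"
  assumes "Ck (Suc (Suc 0)) h" shows "transpose (hess h x) = hess h x"
proof -
  let ?D = "\<lambda>v x. frechet_derivative h (at x) v"
  have d: "\<And>x. h differentiable (at x)" and dD: "\<And>v x. ?D v differentiable (at x)"
    and cont: "\<And>v w. continuous_on UNIV (\<lambda>x. frechet_derivative (?D v) (at x) w)"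
    using assms by simp_all
  have "hess h x $ i $ j = frechet_derivative (?D (axis i 1)) (at x) (axis j 1)" for i j
  proof -
    have "(\<lambda>x. grad h x $ j) differentiable (at x)" for j
      by (rule C1_on_differentiable[OF Ck_2_imp_C1_on_grad[OF assms]]) simp
    then have "(grad h has_derivative (\<lambda>p. hess h x *v p)) (at x)"
      by (rule has_derivative_grad)
    then have "((\<lambda>x. grad h x $ i) has_derivative (\<lambda>p. (hess h x *v p) $ i)) (at x)"
      by (rule bounded_linear.has_derivative[OF bounded_linear_vec_nth])
    then have "frechet_derivative (\<lambda>x. grad h x $ i) (at x) = (\<lambda>p. (hess h x *v p) $ i)"
      using frechet_derivative_at by metis
    then have "frechet_derivative (?D (axis i 1)) (at x) = (\<lambda>p. (hess h x *v p) $ i)"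
      by (simp add: grad_def)
    then show ?thesis by (simp add: matrix_vector_mult_basis column_def)
  qed
  then show ?thesis
    using symmetric_second_derivative[OF d dD cont] by (simp add: vec_eq_iff transpose_def)
qed

section \<open>Symmetric matrices\<close>

lemma inner_matrix_vector_transpose:
  fixes M :: "real^'m^'n"
  shows "x \<bullet> (M *v y) = (transpose M *v x) \<bullet> y"
  by (simp add: dot_lmul_matrix[symmetric])

lemma inner_symmetric_matrix:
  fixes M :: "real^'n^'n"
  assumes "transpose M = M"
  shows "x \<bullet> (M *v y) = (M *v x) \<bullet> y"
  using inner_matrix_vector_transpose[of x M y] assms by simp

text \<open>
  Eigenvectors to different eigenvalues are orthogonal, and an orthogonal family of nonzero vectors
  is linearly independent. Finiteness is what makes the \<open>Max\<close> in \<open>lambda_max\<close> meaningful.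
\<close>

lemma finite_eigenvalues_symmetric:
  fixes M :: "real^'n^'n"
  assumes sym: "transpose M = M"
  shows "finite {k. \<exists>v. v \<noteq> 0 \<and> M *v v = k *\<^sub>R v}"
proof -
  define E where "E = {k. \<exists>v. v \<noteq> 0 \<and> M *v v = k *\<^sub>R v}"
  have "\<forall>k\<in>E. \<exists>v. v \<noteq> 0 \<and> M *v v = k *\<^sub>R v" by (simp add: E_def)
  then obtain v where v: "\<And>k. k \<in> E \<Longrightarrow> v k \<noteq> 0" "\<And>k. k \<in> E \<Longrightarrow> M *v v k = k *\<^sub>R v k"
    by metis
  have orth: "v k \<bullet> v k' = 0" if "k \<in> E" "k' \<in> E" "k \<noteq> k'" for k k'
  proof -
    have "k' * (v k \<bullet> v k') = k * (v k \<bullet> v k')"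
      using inner_symmetric_matrix[OF sym, of "v k" "v k'"] v(2)[OF that(1)] v(2)[OF that(2)] by simp
    then show ?thesis using that(3) by simp
  qed
  have inj: "inj_on v E"
  proof (rule inj_onI)
    fix k k' assume k: "k \<in> E" "k' \<in> E" and eq: "v k = v k'"
    show "k = k'"
    proof (rule ccontr)
      assume "k \<noteq> k'"
      then have "v k \<bullet> v k = 0" using orth[OF k] eq by simp
      then show False using v(1)[OF k(1)] by simp
    qed
  qed
  have "pairwise orthogonal (v ` E)"
    unfolding pairwise_def orthogonal_def using orth by auto
  moreover have "0 \<notin> v ` E" using v(1) by auto
  ultimately have "finite (v ` E)"
    by (intro independent_imp_finite pairwise_orthogonal_independent)
  then have "finite E" using inj by (rule finite_imageD)
  then show ?thesis by (simp add: E_def)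
qed

text \<open>
  Moving from the maximiser \<open>v0\<close> in the direction \<open>d = M v0 - k v0\<close> changes the form
  \<open>v \<bullet> M v - k (v \<bullet> v)\<close> by \<open>2 t (d \<bullet> d)\<close> to first order in \<open>t\<close>, so it would become positive unless
  \<open>d = 0\<close>.
\<close>

lemma rayleigh_maximiser_is_eigenvector:
  fixes M :: "real^'n^'n"
  assumes sym: "transpose M = M"
    and max: "\<And>v. v \<bullet> (M *v v) \<le> k * (v \<bullet> v)"
    and att: "v0 \<bullet> (M *v v0) = k * (v0 \<bullet> v0)"
  shows "M *v v0 = k *\<^sub>R v0"
proof (rule ccontr)
  define d where "d = M *v v0 - k *\<^sub>R v0"
  define C where "C = d \<bullet> (M *v d) - k * (d \<bullet> d)"
  assume "M *v v0 \<noteq> k *\<^sub>R v0"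
  then have pos: "0 < d \<bullet> d" by (simp add: d_def)
  have ineq: "2 * t * (d \<bullet> d) + t\<^sup>2 * C \<le> 0" for t
  proof -
    have dM: "d \<bullet> (M *v v0) = d \<bullet> d + k * (d \<bullet> v0)"
      unfolding d_def by (simp add: inner_diff_right inner_diff_left algebra_simps)
    have Md: "v0 \<bullet> (M *v d) = d \<bullet> (M *v v0)"
      using inner_symmetric_matrix[OF sym, of v0 d] by (simp add: inner_commute)
    have "(v0 + t *\<^sub>R d) \<bullet> (M *v (v0 + t *\<^sub>R d))
        = k * (v0 \<bullet> v0) + 2 * t * (d \<bullet> d + k * (d \<bullet> v0)) + t\<^sup>2 * (d \<bullet> (M *v d))"
      using att dM Md
      by (simp add: matrix_vector_right_distrib matrix_vector_mult_scaleR inner_add_left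
          inner_add_right algebra_simps power2_eq_square)
    moreover have "k * ((v0 + t *\<^sub>R d) \<bullet> (v0 + t *\<^sub>R d))
        = k * (v0 \<bullet> v0) + 2 * t * (k * (d \<bullet> v0)) + t\<^sup>2 * (k * (d \<bullet> d))"
      by (simp add: inner_add_left inner_add_right algebra_simps power2_eq_square inner_commute)
    ultimately show ?thesis
      using max[of "v0 + t *\<^sub>R d"] by (simp add: C_def algebra_simps)
  qed
  \<comment> \<open>Short enough for the quadratic term \<open>t\<^sup>2 C\<close> not to outweigh the linear one.\<close>
  define t where "t = (d \<bullet> d) / (\<bar>C\<bar> + 1)"
  have t: "0 < t" using pos by (simp add: t_def)
  have "t * (2 * (d \<bullet> d) + t * C) \<le> 0" using ineq[of t] by (simp add: algebra_simps power2_eq_square)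
  then have "2 * (d \<bullet> d) + t * C \<le> 0" using t by (simp add: mult_le_0_iff)
  moreover have "- (t * C) \<le> t * (\<bar>C\<bar> + 1)" using t by (simp add: algebra_simps abs_if)
  moreover have "t * (\<bar>C\<bar> + 1) = d \<bullet> d"
    unfolding t_def by (simp add: add_pos_nonneg less_imp_neq[symmetric] add_nonneg_pos)
  ultimately show False using pos by linarith
qed

text \<open>
  The Rayleigh quotient attains its maximum on the unit sphere, at an eigenvector; no eigenvalue
  exceeds this maximum, since each is the Rayleigh quotient of its eigenvectors.
\<close>

lemma lambda_max_symmetric:
  fixes M :: "real^'n^'n"
  assumes sym: "transpose M = M"
  obtains v where "v \<noteq> 0" "M *v v = lambda_max M *\<^sub>R v"
    and "\<And>w. w \<bullet> (M *v w) \<le> lambda_max M * (w \<bullet> w)"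
proof -
  let ?E = "{k. \<exists>v. v \<noteq> 0 \<and> M *v v = k *\<^sub>R v}"
  have "compact (sphere (0::real^'n) 1)" by simp
  moreover have "sphere (0::real^'n) 1 \<noteq> {}" by simp
  moreover have "continuous_on (sphere 0 1) (\<lambda>v. v \<bullet> (M *v v))"
    by (intro continuous_on_inner continuous_on_id linear_continuous_on matrix_vector_mul_bounded_linear)
  ultimately have "\<exists>v0\<in>sphere 0 1. \<forall>v\<in>sphere 0 1. v \<bullet> (M *v v) \<le> v0 \<bullet> (M *v v0)"
    by (rule continuous_attains_sup)
  then obtain v0 where v0: "v0 \<in> sphere 0 1"
    "\<And>v. v \<in> sphere 0 1 \<Longrightarrow> v \<bullet> (M *v v) \<le> v0 \<bullet> (M *v v0)"
    by blast
  define k where "k = v0 \<bullet> (M *v v0)"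
  have max: "w \<bullet> (M *v w) \<le> k * (w \<bullet> w)" for w
  proof (cases "w = 0")
    case False
    have "(w /\<^sub>R norm w) \<bullet> (M *v (w /\<^sub>R norm w)) \<le> k"
      using v0(2)[of "w /\<^sub>R norm w"] False by (simp add: k_def)
    then have "(w \<bullet> (M *v w)) / (norm w)\<^sup>2 \<le> k"
      by (simp add: matrix_vector_mult_scaleR divide_inverse power2_eq_square mult_ac)
    then show ?thesis using False by (simp add: power2_norm_eq_inner divide_le_eq)
  qed simp
  have "v0 \<bullet> v0 = 1" using v0(1) by (simp add: norm_eq_1)
  then have eig: "M *v v0 = k *\<^sub>R v0"
    by (intro rayleigh_maximiser_is_eigenvector[OF sym max]) (simp add: k_def)
  have ne: "v0 \<noteq> 0" using v0(1) by auto
  have "k \<in> ?E" by (intro CollectI exI[of _ v0] conjI ne eig)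
  moreover have "k' \<le> k" if k': "k' \<in> ?E" for k'
  proof -
    obtain v where v: "v \<noteq> 0" "M *v v = k' *\<^sub>R v" using k' by blast
    then have "k' * (v \<bullet> v) \<le> k * (v \<bullet> v)" using max[of v] by simp
    moreover have "0 < v \<bullet> v" using v(1) by simp
    ultimately show ?thesis by simp
  qed
  ultimately have "Max ?E = k"
    using finite_eigenvalues_symmetric[OF sym] by (intro Max_eqI)
  then have "lambda_max M = k" by (simp add: lambda_max_def)
  then show thesis using that[of v0] eig ne max by metis
qed

section \<open>The orthogonal projector onto the range of an injective matrix\<close>

lemma inj_matrix_vector_mult_iff:
  fixes A :: "real^'m^'n"
  shows "inj ((*v) A) \<longleftrightarrow> (\<forall>y. A *v y = 0 \<longrightarrow> y = 0)"
  using matrix_left_invertible_injective[of A] matrix_left_invertible_ker[of A] by simp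

lemma gram_matrix_inverse:
  fixes A :: "real^'m^'n"
  assumes inj: "inj ((*v) A)"
  defines "G \<equiv> transpose A ** A"
  shows "matrix_inv G ** G = mat 1" "G ** matrix_inv G = mat 1"
    and "transpose (matrix_inv G) = matrix_inv G"
proof -
  have "y = 0" if "G *v y = 0" for y
  proof -
    have "(A *v y) \<bullet> (A *v y) = y \<bullet> (G *v y)"
      unfolding G_def
      using inner_matrix_vector_transpose[of y "transpose A" "A *v y"]
      by (simp add: matrix_vector_mul_assoc)
    then show ?thesis using that inj unfolding inj_matrix_vector_mult_iff by simp
  qed
  then have "\<exists>B. B ** G = mat 1" by (simp add: matrix_left_invertible_ker)
  then have inv: "invertible G" by (simp add: invertible_left_inverse)
  then have "G ** matrix_inv G = mat 1 \<and> matrix_inv G ** G = mat 1"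
    unfolding invertible_def matrix_inv_def by (rule someI_ex)
  then show l: "matrix_inv G ** G = mat 1" and r: "G ** matrix_inv G = mat 1" by auto
  have "transpose G = G" unfolding G_def by (simp add: matrix_transpose_mul)
  then have "transpose (matrix_inv G) ** G = mat 1"
    using arg_cong[OF r, of transpose] by (simp add: matrix_transpose_mul)
  then show "transpose (matrix_inv G) = matrix_inv G"
    using r by (metis matrix_mul_assoc matrix_mul_lid matrix_mul_rid)
qed

lemma range_projector:
  fixes A :: "real^'m^'n"
  assumes inj: "inj ((*v) A)"
  defines "P \<equiv> A ** matrix_inv (transpose A ** A) ** transpose A"
  shows "transpose P = P" "P *v (P *v v) = P *v v" "transpose A *v (P *v v) = transpose A *v v"
    "\<exists>y. P *v v = A *v y"
proof -
  note G = gram_matrix_inverse[of A, OF inj]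
  show "transpose P = P" unfolding P_def by (simp add: matrix_transpose_mul G matrix_mul_assoc)
  have "transpose A ** P = ((transpose A ** A) ** matrix_inv (transpose A ** A)) ** transpose A"
    unfolding P_def by (simp only: matrix_mul_assoc)
  then have AP: "transpose A ** P = transpose A" by (simp add: G)
  then show "transpose A *v (P *v v) = transpose A *v v" by (simp add: matrix_vector_mul_assoc)
  have "P ** P = (A ** matrix_inv (transpose A ** A)) ** (transpose A ** P)"
    by (simp add: P_def matrix_mul_assoc)
  also have "\<dots> = P" unfolding AP by (simp add: P_def)
  finally show "P *v (P *v v) = P *v v" by (simp add: matrix_vector_mul_assoc)
  show "\<exists>y. P *v v = A *v y"
    unfolding P_def by (metis matrix_mul_assoc matrix_vector_mul_assoc)
qed

text \<open>
  The hypothesis on \<open>\<eta>\<close> determines \<open>A \<eta> = P (B v - \<sigma> v)\<close>. Eliminating \<open>\<eta>\<close> leaves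
  \<open>v \<bullet> B v - 2 (P v \<bullet> B v) + 2 \<sigma> (P v \<bullet> P v)\<close>, and for symmetric \<open>B\<close> the mixed terms of the
  decomposition \<open>v = (v - P v) + P v\<close> cancel.
\<close>

lemma quadratic_form_split:
  fixes A :: "real^'m^'n" and B :: "real^'n^'n"
  assumes inj: "inj ((*v) A)"
    and sym: "transpose B = B"
    and \<eta>: "transpose A *v (A *v \<eta>) = transpose A *v (B *v v - \<sigma> *\<^sub>R v)"
  defines "P \<equiv> A ** matrix_inv (transpose A ** A) ** transpose A"
  shows "v \<bullet> (B *v v) - 2 * (v \<bullet> (A *v \<eta>))
    = (v - P *v v) \<bullet> (B *v (v - P *v v)) - (P *v v) \<bullet> (B *v (P *v v)) + 2 * \<sigma> * ((P *v v) \<bullet> (P *v v))"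
proof -
  note P = range_projector[of A, OF inj, folded P_def]
  have "\<eta> = matrix_inv (transpose A ** A) *v (transpose A *v (B *v v - \<sigma> *\<^sub>R v))"
    unfolding \<eta>[symmetric] using gram_matrix_inverse(1)[of A, OF inj]
    by (metis matrix_vector_mul_assoc matrix_vector_mul_lid)
  then have "A *v \<eta> = P *v (B *v v - \<sigma> *\<^sub>R v)"
    by (simp add: P_def matrix_vector_mul_assoc matrix_mul_assoc del: transpose_matrix_vector)
  then have "v \<bullet> (A *v \<eta>) = (P *v v) \<bullet> (B *v v) - \<sigma> * ((P *v v) \<bullet> v)"
    using inner_symmetric_matrix[OF P(1)] by (simp add: inner_diff_right)
  moreover have "(P *v v) \<bullet> v = (P *v v) \<bullet> (P *v v)"
    using inner_symmetric_matrix[OF P(1), of "P *v v" v] P(2)[of v] by (simp add: inner_commute)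
  moreover have "v \<bullet> (B *v (P *v v)) = (P *v v) \<bullet> (B *v v)"
    using inner_symmetric_matrix[OF sym, of v "P *v v"] by (simp add: inner_commute)
  ultimately show ?thesis
    by (simp add: matrix_vector_mult_diff_distrib inner_diff_left inner_diff_right algebra_simps)
qed

text \<open>
  An eigenvector of \<open>P B P\<close> to a nonzero eigenvalue lies in the range of \<open>P\<close>. The eigenvalue \<open>0\<close> has to
  be set apart: it also belongs to the kernel of \<open>P\<close>.
\<close>

lemma projected_lambda_max:
  fixes B P :: "real^'n^'n"
  assumes B: "transpose B = B" and P: "transpose P = P" "\<And>v. P *v (P *v v) = P *v v"
  defines "k \<equiv> lambda_max (P ** B ** P)"
  shows "k = 0 \<or> (\<exists>e. e \<noteq> 0 \<and> P *v e = e \<and> e \<bullet> (B *v e) = k * (e \<bullet> e))"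
    and "(P *v v) \<bullet> (B *v (P *v v)) \<le> k * ((P *v v) \<bullet> (P *v v))"
proof -
  have "transpose (P ** B ** P) = P ** B ** P"
    using B P(1) by (simp add: matrix_transpose_mul matrix_mul_assoc)
  then obtain e where e: "e \<noteq> 0" "(P ** B ** P) *v e = k *\<^sub>R e"
    and max: "\<And>w. w \<bullet> ((P ** B ** P) *v w) \<le> k * (w \<bullet> w)"
    unfolding k_def using lambda_max_symmetric by metis
  have PBP: "w \<bullet> ((P ** B ** P) *v w) = (P *v w) \<bullet> (B *v (P *v w))" for w
    using inner_symmetric_matrix[OF P(1), of w] by (simp add: matrix_vector_mul_assoc[symmetric])
  show "(P *v v) \<bullet> (B *v (P *v v)) \<le> k * ((P *v v) \<bullet> (P *v v))"
    using max[of "P *v v"] unfolding PBP P(2) .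
  show "k = 0 \<or> (\<exists>e. e \<noteq> 0 \<and> P *v e = e \<and> e \<bullet> (B *v e) = k * (e \<bullet> e))"
  proof (cases "k = 0")
    case False
    \<comment> \<open>A vector that \<open>P\<close> maps to \<open>e\<close>; it shows that \<open>e\<close> lies in the range of \<open>P\<close>.\<close>
    define w where "w = (1 / k) *\<^sub>R (B *v (P *v e))"
    have "P *v w = (1 / k) *\<^sub>R ((P ** B ** P) *v e)"
      unfolding w_def by (simp add: matrix_vector_mult_scaleR matrix_vector_mul_assoc[symmetric])
    also have "\<dots> = e" using False by (simp add: e(2))
    finally have Pw: "P *v w = e" .
    have Pe: "P *v e = e" using P(2)[of w] unfolding Pw .
    have "e \<bullet> (B *v e) = k * (e \<bullet> e)"
      using PBP[of e] unfolding e(2) Pe by simp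
    then show ?thesis using e(1) Pe by blast
  qed simp
qed

text \<open>
  For necessity the form is evaluated at an eigenvector in the range of \<open>P\<close>, where the term in
  \<open>v - P v\<close> disappears. If the largest eigenvalue is \<open>0\<close> there may be no such eigenvector, and the
  bound is instead the positivity of \<open>\<sigma>\<close>. The set \<open>T\<close> stands for the directions under test.
\<close>

lemma split_form_nonneg_iff:
  fixes B P :: "real^'n^'n"
  assumes B: "transpose B = B" and P: "transpose P = P" "\<And>v. P *v (P *v v) = P *v v"
    and sigma: "0 < \<sigma>"
    and T: "\<And>v. P *v v \<in> T"
    and ker: "\<And>v. v \<in> T \<Longrightarrow> 0 \<le> (v - P *v v) \<bullet> (B *v (v - P *v v))"
  shows "(\<forall>v\<in>T. 0 \<le> (v - P *v v) \<bullet> (B *v (v - P *v v)) - (P *v v) \<bullet> (B *v (P *v v))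
            + 2 * \<sigma> * ((P *v v) \<bullet> (P *v v)))
    \<longleftrightarrow> \<sigma> \<ge> 1/2 * lambda_max (P ** B ** P)" (is "(\<forall>v\<in>T. 0 \<le> ?\<psi> v) \<longleftrightarrow> \<sigma> \<ge> 1/2 * ?k")
proof
  assume R: "\<forall>v\<in>T. 0 \<le> ?\<psi> v"
  show "\<sigma> \<ge> 1/2 * ?k"
  proof (cases "?k = 0")
    case False
    then obtain e where e: "e \<noteq> 0" "P *v e = e" "e \<bullet> (B *v e) = ?k * (e \<bullet> e)"
      using projected_lambda_max(1)[OF B P] by blast
    have "e \<in> T" using T[of e] by (simp add: e(2))
    then have "0 \<le> ?\<psi> e" using R by blast
    then have "?k * (e \<bullet> e) \<le> (2 * \<sigma>) * (e \<bullet> e)" by (simp add: e(2,3))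
    moreover have "0 < e \<bullet> e" using e(1) by simp
    ultimately show ?thesis by (simp only: mult_le_cancel_right_pos)
  qed (use sigma in simp)
next
  assume L: "\<sigma> \<ge> 1/2 * ?k"
  show "\<forall>v\<in>T. 0 \<le> ?\<psi> v"
  proof
    fix v assume v: "v \<in> T"
    have "0 \<le> (2 * \<sigma> - ?k) * ((P *v v) \<bullet> (P *v v))"
      using L by (intro mult_nonneg_nonneg) auto
    then show "0 \<le> ?\<psi> v"
      using ker[OF v] projected_lambda_max(2)[OF B P, of v] unfolding left_diff_distrib by linarith
  qed
qed

text \<open>
  The strict version needs a positive contribution from every nonzero \<open>v\<close>. If \<open>v - P v\<close> is nonzero, the
  first term provides it; otherwise \<open>v = P v\<close>, and it comes from the gap between \<open>2 \<sigma>\<close> and the largest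
  eigenvalue.
\<close>

lemma split_form_pos_iff:
  fixes B P :: "real^'n^'n"
  assumes B: "transpose B = B" and P: "transpose P = P" "\<And>v. P *v (P *v v) = P *v v"
    and sigma: "0 < \<sigma>"
    and T: "\<And>v. P *v v \<in> T"
    and ker: "\<And>v. v \<in> T \<Longrightarrow> v - P *v v \<noteq> 0 \<Longrightarrow> 0 < (v - P *v v) \<bullet> (B *v (v - P *v v))"
  shows "(\<forall>v\<in>T. v \<noteq> 0 \<longrightarrow>
          0 < (v - P *v v) \<bullet> (B *v (v - P *v v)) - (P *v v) \<bullet> (B *v (P *v v))
            + 2 * \<sigma> * ((P *v v) \<bullet> (P *v v)))
    \<longleftrightarrow> \<sigma> > 1/2 * lambda_max (P ** B ** P)"
    (is "(\<forall>v\<in>T. v \<noteq> 0 \<longrightarrow> 0 < ?\<psi> v) \<longleftrightarrow> \<sigma> > 1/2 * ?k")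
proof
  assume R: "\<forall>v\<in>T. v \<noteq> 0 \<longrightarrow> 0 < ?\<psi> v"
  show "\<sigma> > 1/2 * ?k"
  proof (cases "?k = 0")
    case False
    then obtain e where e: "e \<noteq> 0" "P *v e = e" "e \<bullet> (B *v e) = ?k * (e \<bullet> e)"
      using projected_lambda_max(1)[OF B P] by blast
    have "e \<in> T" using T[of e] by (simp add: e(2))
    then have "0 < ?\<psi> e" using R e(1) by blast
    then have "?k * (e \<bullet> e) < (2 * \<sigma>) * (e \<bullet> e)" by (simp add: e(2,3))
    moreover have "0 < e \<bullet> e" using e(1) by simp
    ultimately show ?thesis by (simp only: mult_less_cancel_right_pos)
  qed (use sigma in simp)
next
  assume L: "\<sigma> > 1/2 * ?k"
  show "\<forall>v\<in>T. v \<noteq> 0 \<longrightarrow> 0 < ?\<psi> v"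
  proof (intro ballI impI)
    fix v assume v: "v \<in> T" "v \<noteq> 0"
    have max: "(P *v v) \<bullet> (B *v (P *v v)) \<le> ?k * ((P *v v) \<bullet> (P *v v))"
      by (rule projected_lambda_max(2)[OF B P])
    show "0 < ?\<psi> v"
    proof (cases "v - P *v v = 0")
      case True
      then have "P *v v \<noteq> 0" using v(2) by simp
      then have "0 < (2 * \<sigma> - ?k) * ((P *v v) \<bullet> (P *v v))"
        using L by (intro mult_pos_pos) auto
      then show ?thesis using max True unfolding left_diff_distrib by simp
    next
      case False
      have "0 \<le> (2 * \<sigma> - ?k) * ((P *v v) \<bullet> (P *v v))"
        using L by (intro mult_nonneg_nonneg) auto
      then show ?thesis using ker[OF v(1) False] max unfolding left_diff_distrib by linarith
    qed
  qed
qed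

section \<open>The scaling function\<close>

lemma DERIV_pos_part_square:
  "((\<lambda>t. (max 0 t)\<^sup>2) has_real_derivative 2 * max 0 t) (at (t::real))"
proof (cases t "0::real" rule: linorder_cases)
  case less
  have "((\<lambda>t::real. 0) has_real_derivative 2 * max 0 t) (at t)" using less by simp
  then show ?thesis
    by (rule has_field_derivative_transform_within_open[where S = "{..<0}"]) (use less in auto)
next
  case greater
  have "((\<lambda>t::real. t\<^sup>2) has_real_derivative 2 * max 0 t) (at t)"
    using greater by (auto intro!: derivative_eq_intros)
  then show ?thesis
    by (rule has_field_derivative_transform_within_open[where S = "{0<..}"]) (use greater in auto)
next
  case equal
  have "((\<lambda>h. max 0 h) \<longlongrightarrow> max 0 0) (at (0::real))" by (intro tendsto_intros)
  moreover have "(max 0 h)\<^sup>2 / h = max 0 h" for h :: real by (simp add: max_def power2_eq_square)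
  ultimately show ?thesis unfolding equal DERIV_def by simp
qed

text \<open>
  The middle piece of the scaling function is a parabola in \<open>2 t - b - a\<close>. Adding the squares of the
  positive parts beyond \<open>\<plusminus>w\<close> continues it by its tangents, which are exactly the distances to
  the bounds. In this form continuous differentiability across the breakpoints is evident.
\<close>

lemma qscale_finite:
  assumes "0 < w" "w < b - a"
  shows "qscale (ereal a) (ereal b) w t
    = (b - a) / 2 - w / 4 - (2 * t - b - a)\<^sup>2 / (4 * w)
      + ((max 0 (2 * t - b - a - w))\<^sup>2 + (max 0 (- (2 * t - b - a) - w))\<^sup>2) / (4 * w)"
proof -
  define s where "s = 2 * t - b - a"
  have cond: "\<bar>ereal b + ereal a - ereal (2 * t)\<bar> \<le> ereal w \<longleftrightarrow> \<bar>s\<bar> \<le> w"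
    by (auto simp: s_def abs_if)
  have q: "qscale (ereal a) (ereal b) w t
      = (if \<bar>s\<bar> \<le> w then (b - a) / 2 - w / 4 - s\<^sup>2 / (4 * w) else min (t - a) (b - t))"
    unfolding qscale_def cond by (auto simp: s_def min_def)
  have t: "t = (s + b + a) / 2" by (simp add: s_def)
  consider "\<bar>s\<bar> \<le> w" | "s > w" | "s < - w" using assms by linarith
  then show ?thesis
  proof cases
    case 1
    then have "max 0 (s - w) = 0" "max 0 (- s - w) = 0" by auto
    then show ?thesis unfolding q s_def[symmetric] using 1 by simp
  next
    case 2
    then have "max 0 (s - w) = s - w" "max 0 (- s - w) = 0" "\<not> \<bar>s\<bar> \<le> w" using assms by auto
    moreover have "min (t - a) (b - t) = b - t" using 2 assms unfolding s_def by (simp add: min_def)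
    moreover have "b - t = (b - a) / 2 - w / 4 - s\<^sup>2 / (4 * w) + (s - w)\<^sup>2 / (4 * w)"
      using assms unfolding t by (simp add: field_simps power2_eq_square)
    ultimately show ?thesis unfolding q s_def[symmetric] using 2 by simp
  next
    case 3
    then have "max 0 (s - w) = 0" "max 0 (- s - w) = - s - w" "\<not> \<bar>s\<bar> \<le> w" using assms by auto
    moreover have "min (t - a) (b - t) = t - a" using 3 assms unfolding s_def by (simp add: min_def)
    moreover have "t - a = (b - a) / 2 - w / 4 - s\<^sup>2 / (4 * w) + (- s - w)\<^sup>2 / (4 * w)"
      using assms unfolding t by (simp add: field_simps power2_eq_square)
    ultimately show ?thesis unfolding q s_def[symmetric] using 3 by simp
  qed
qed

lemma qscale_left_bounded: "qscale (ereal a) \<infinity> w t = t - a"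
  by (simp add: qscale_def min_def)

lemma qscale_right_bounded: "qscale (-\<infinity>) (ereal b) w t = b - t"
  by (simp add: qscale_def min_def)

lemma bounds_cases:
  assumes "l < (u::ereal)"
  obtains "l = -\<infinity>" "u = \<infinity>" | a where "l = ereal a" "u = \<infinity>" | b where "l = -\<infinity>" "u = ereal b"
    | a b where "l = ereal a" "u = ereal b"
  using assms by (cases l; cases u) auto

text \<open>
  Only the case of two finite bounds has breakpoints; otherwise the function is affine.
\<close>

lemma qscale_C1:
  assumes "0 < w" "ereal w < u - l" "l < u"
  shows "\<exists>q'. (\<forall>t. (qscale l u w has_real_derivative q' t) (at t)) \<and> continuous_on UNIV q'"
  using assms(3)
proof (cases rule: bounds_cases)
  case 1
  then have "qscale l u w = (\<lambda>t. 1)" by (auto simp: qscale_def)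
  then show ?thesis by (intro exI[of _ "\<lambda>t. 0"]) simp
next
  case (2 a)
  then have "qscale l u w = (\<lambda>t. t - a)" by (auto simp: qscale_left_bounded)
  then show ?thesis by (intro exI[of _ "\<lambda>t. 1"]) (auto intro!: derivative_eq_intros)
next
  case (3 b)
  then have "qscale l u w = (\<lambda>t. b - t)" by (auto simp: qscale_right_bounded)
  then show ?thesis by (intro exI[of _ "\<lambda>t. - 1"]) (auto intro!: derivative_eq_intros)
next
  case (4 a b)
  then have "w < b - a" using assms(2) by simp
  then have q: "qscale l u w = (\<lambda>t. (b - a) / 2 - w / 4 - (2 * t - b - a)\<^sup>2 / (4 * w)
      + ((max 0 (2 * t - b - a - w))\<^sup>2 + (max 0 (- (2 * t - b - a) - w))\<^sup>2) / (4 * w))"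
    unfolding 4 using qscale_finite[OF assms(1)] by blast
  have p1: "((\<lambda>t. (max 0 (2 * t - b - a - w))\<^sup>2) has_real_derivative
      2 * max 0 (2 * t - b - a - w) * 2) (at t)" for t
    by (rule DERIV_chain2[OF DERIV_pos_part_square]) (auto intro!: derivative_eq_intros)
  have p2: "((\<lambda>t. (max 0 (- (2 * t - b - a) - w))\<^sup>2) has_real_derivative
      2 * max 0 (- (2 * t - b - a) - w) * (- 2)) (at t)" for t
    by (rule DERIV_chain2[OF DERIV_pos_part_square]) (auto intro!: derivative_eq_intros)
  have p0: "((\<lambda>t. (2 * t - b - a)\<^sup>2) has_real_derivative 2 * (2 * t - b - a) * 2) (at t)" for t
    by (auto intro!: derivative_eq_intros)
  let ?q' = "\<lambda>t. (0 - 0 - 2 * (2 * t - b - a) * 2 / (4 * w))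
      + (2 * max 0 (2 * t - b - a - w) * 2 + 2 * max 0 (- (2 * t - b - a) - w) * (- 2)) / (4 * w)"
  have "(qscale l u w has_real_derivative ?q' t) (at t)" for t
    unfolding q by (intro DERIV_add DERIV_diff DERIV_cdivide DERIV_const p0 p1 p2)
  moreover have "continuous_on UNIV ?q'"
    by (intro continuous_intros) (use assms(1) in auto)
  ultimately show ?thesis by (intro exI[of _ ?q']) blast
qed

lemma qscale_pos:
  assumes "0 < w" "ereal w < u - l" "l < ereal t" "ereal t < u"
  shows "0 < qscale l u w t"
proof -
  have "l < u" using assms(3,4) by simp
  then show ?thesis
  proof (cases rule: bounds_cases)
    case (4 a b)
    have t: "a < t" "t < b" and w: "w < b - a" using assms 4 by auto
    define X where "X = (2 * t - b - a)\<^sup>2 / (4 * w)"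
    have "0 < (b - a) / 2 - w / 4 - X" if "\<bar>2 * t - b - a\<bar> \<le> w"
    proof -
      have "(2 * t - b - a)\<^sup>2 \<le> w\<^sup>2" using that by (metis abs_le_square_iff abs_of_pos assms(1))
      then have "X \<le> w / 4"
        using assms(1) by (simp add: X_def field_simps power2_eq_square)
      moreover have "w / 2 < (b - a) / 2" using w by simp
      moreover have "w / 4 + w / 4 = w / 2" by simp
      ultimately show ?thesis by linarith
    qed
    moreover have "\<bar>ereal b + ereal a - ereal (2 * t)\<bar> \<le> ereal w \<longleftrightarrow> \<bar>2 * t - b - a\<bar> \<le> w"
      by (auto simp: abs_if)
    ultimately show ?thesis using t unfolding 4 qscale_def by (auto simp: min_def X_def)
  qed (use assms in \<open>auto simp: qscale_left_bounded qscale_right_bounded qscale_def[of "-\<infinity>" \<infinity>]\<close>)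
qed

lemma qscale_at_bound:
  assumes "0 < w" "ereal w < u - l" "l < u" "ereal t = l \<or> ereal t = u"
  shows "qscale l u w t = 0"
  using assms(3)
proof (cases rule: bounds_cases)
  case (4 a b)
  then have "t = a \<or> t = b" and w: "w < b - a" using assms by auto
  moreover have "\<not> \<bar>ereal b + ereal a - ereal (2 * t)\<bar> \<le> ereal w"
    using calculation assms(1) by (auto simp: abs_if)
  ultimately show ?thesis using assms(1) unfolding 4 qscale_def by (auto simp: min_def)
qed (use assms in \<open>auto simp: qscale_left_bounded qscale_right_bounded\<close>)

section \<open>The multiplier function\<close>

lemma diag_mult_vec: "(diag d *v v) $ j = d $ j * v $ j"
  by (simp add: diag_def matrix_vector_mult_def if_distrib[of "\<lambda>x. x * _"] cong: if_cong)

lemma transpose_diag: "transpose (diag d) = diag d"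
  by (simp add: diag_def transpose_def vec_eq_iff)

text \<open>
  The standing data without any of the stationary points. The conditions at particular points
  (regularity, constraint qualification, complementarity) enter the individual lemmas.
\<close>

locale scaled_problem =
  fixes f :: "real^'n \<Rightarrow> real" and c :: "real^'n \<Rightarrow> real^'m"
    and l u :: "ereal^'n" and \<omega> :: "real^'n"
  assumes omega: "\<And>j. 0 < \<omega> $ j \<and> ereal (\<omega> $ j) < u $ j - l $ j"
    and bounds: "\<And>j. l $ j < u $ j"
    and smooth_f: "Ck 3 f" and smooth_c: "Ck 3 c"
begin

text \<open>
  The normal equations of the least squares problem are \<open>gram x *v y = rhs \<sigma> x\<close>.
\<close>

definition gram :: "real^'n \<Rightarrow> real^'m^'m" where
  "gram x = transpose (Amat c x) ** Qmat l u \<omega> x ** Amat c x"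

definition rhs :: "real \<Rightarrow> real^'n \<Rightarrow> real^'m" where
  "rhs \<sigma> x = transpose (Amat c x) *v (Qmat l u \<omega> x *v grad f x) - \<sigma> *\<^sub>R c x"

text \<open>
  Positive definiteness of the Gram matrix, rather than injectivity of \<open>AQ\<close>, is the condition that
  makes the multipliers well behaved also at nearby points outside the box, where \<open>Q\<close> has negative
  entries and its square root no longer represents it.
\<close>

definition regular :: "real^'n \<Rightarrow> bool" where
  "regular x \<longleftrightarrow> (\<forall>y. y \<noteq> 0 \<longrightarrow> 0 < y \<bullet> (gram x *v y))"

abbreviation y_opt :: "real \<Rightarrow> real^'n \<Rightarrow> real^'m" where
  "y_opt \<equiv> ysol f c l u \<omega>"

lemma Ck_2_f: "Ck (Suc (Suc 0)) f"
  using Ck_Suc_imp_Ck[of 2 f] smooth_f by (simp only: numeral_3_eq_3 numeral_2_eq_2)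

lemma Ck_2_c: "Ck (Suc (Suc 0)) (\<lambda>x. c x $ i)"
  using Ck_Suc_imp_Ck[OF Ck_component, of 2 c i] smooth_c by (simp only: numeral_3_eq_3 numeral_2_eq_2)

lemma C1_f: "C1_on UNIV f"
  using Ck_Suc_imp_Ck[OF Ck_2_f] by (rule Ck_1_imp_C1_on)

lemma C1_c: "C1_on UNIV (\<lambda>x. c x $ i)"
  using Ck_Suc_imp_Ck[OF Ck_2_c] by (rule Ck_1_imp_C1_on)

lemma C1_grad_f: "C1_on UNIV (\<lambda>x. grad f x $ j)"
  using Ck_2_f by (rule Ck_2_imp_C1_on_grad)

lemma C1_Amat: "C1_on UNIV (\<lambda>x. Amat c x $ j $ i)"
  using Ck_2_imp_C1_on_grad[OF Ck_2_c] by (simp add: Amat_def)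

lemma C1_q: "C1_on UNIV (\<lambda>x. qvec l u \<omega> x $ j)"
proof -
  obtain q' where "\<And>t. (qscale (l $ j) (u $ j) (\<omega> $ j) has_real_derivative q' t) (at t)"
    and "continuous_on UNIV q'"
    using qscale_C1[of "\<omega> $ j" "u $ j" "l $ j"] omega bounds by blast
  from C1_on_component[OF this, of UNIV j] show ?thesis by (simp add: qvec_def)
qed

lemma gram_nth: "gram x $ i $ k = (\<Sum>j\<in>UNIV. Amat c x $ j $ i * (qvec l u \<omega> x $ j * Amat c x $ j $ k))"
proof -
  have "gram x $ i $ k = (gram x *v axis k 1) $ i"
    by (simp add: matrix_vector_mult_basis column_def)
  also have "\<dots> = (transpose (Amat c x) *v (Qmat l u \<omega> x *v (Amat c x *v axis k 1))) $ i"
    by (simp only: gram_def matrix_vector_mul_assoc matrix_mul_assoc)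
  also have "\<dots> = (\<Sum>j\<in>UNIV. Amat c x $ j $ i * (qvec l u \<omega> x $ j * Amat c x $ j $ k))"
    unfolding matrix_vector_mult_def[of "transpose _"]
    by (simp add: transpose_def Qmat_def diag_mult_vec matrix_vector_mult_basis column_def)
  finally show ?thesis .
qed

lemma rhs_nth:
  "rhs \<sigma> x $ i = (\<Sum>j\<in>UNIV. Amat c x $ j $ i * (qvec l u \<omega> x $ j * grad f x $ j)) - \<sigma> * c x $ i"
  unfolding rhs_def matrix_vector_mult_def[of "transpose _"]
  by (simp add: transpose_def Qmat_def diag_mult_vec)

lemma C1_gram: "C1_on UNIV (\<lambda>x. gram x $ i $ k)"
  unfolding gram_nth by (rule C1_on_sum C1_on_mult C1_q C1_Amat)+

lemma C1_rhs: "C1_on UNIV (\<lambda>x. rhs \<sigma> x $ i)"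
  unfolding rhs_nth
  by (rule C1_on_sum C1_on_diff C1_on_mult C1_on_const C1_q C1_Amat C1_grad_f C1_c)+

text \<open>
  On the unit sphere the form of \<open>gram x0\<close> has a positive minimum, and it moves by at most the sum of
  the absolute changes of the matrix entries, which depend continuously on the point.
\<close>

lemma open_regular: "open {x. regular x}"
  unfolding open_contains_ball
proof
  fix x0 assume "x0 \<in> {x. regular x}"
  then have reg: "\<And>y. y \<noteq> 0 \<Longrightarrow> 0 < y \<bullet> (gram x0 *v y)" by (simp add: regular_def)
  have "continuous_on (sphere 0 1) (\<lambda>y. y \<bullet> (gram x0 *v y))"
    by (intro continuous_on_inner continuous_on_id linear_continuous_on matrix_vector_mul_bounded_linear)
  moreover have "compact (sphere (0::real^'m) 1)" "sphere (0::real^'m) 1 \<noteq> {}" by simp_all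
  ultimately have "\<exists>y0\<in>sphere 0 1. \<forall>y\<in>sphere 0 1. y0 \<bullet> (gram x0 *v y0) \<le> y \<bullet> (gram x0 *v y)"
    by (intro continuous_attains_inf)
  then obtain y0 where y0: "y0 \<in> sphere 0 1"
    "\<And>y. y \<in> sphere 0 1 \<Longrightarrow> y0 \<bullet> (gram x0 *v y0) \<le> y \<bullet> (gram x0 *v y)" by blast
  define e where "e = y0 \<bullet> (gram x0 *v y0)"
  have "y0 \<noteq> 0" using y0(1) by auto
  then have e: "0 < e" unfolding e_def by (rule reg)
  define N where "N x = (\<Sum>i\<in>UNIV. \<Sum>k\<in>UNIV. \<bar>gram x $ i $ k - gram x0 $ i $ k\<bar>)" for x
  have "continuous_on UNIV N"
    unfolding N_def[abs_def]
    by (intro continuous_on_sum continuous_on_rabs continuous_on_diff continuous_on_const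
        C1_on_imp_continuous_on[OF C1_gram])
  moreover have "N x0 = 0" by (simp add: N_def)
  ultimately obtain d where d: "d > 0" "\<And>x. dist x x0 < d \<Longrightarrow> dist (N x) 0 < e"
    using e unfolding continuous_on_iff by (metis UNIV_I)
  have "0 < y \<bullet> (gram x *v y)" if x: "x \<in> ball x0 d" and y: "y \<noteq> 0" for x y
  proof -
    define v where "v = y /\<^sub>R norm y"
    have v: "norm v = 1" using y by (simp add: v_def)
    have entry: "\<bar>v $ i * ((gram x $ i $ k - gram x0 $ i $ k) * v $ k)\<bar>
        \<le> \<bar>gram x $ i $ k - gram x0 $ i $ k\<bar>" for i k
    proof -
      have "\<bar>v $ i\<bar> \<le> 1" "\<bar>v $ k\<bar> \<le> 1" using v component_le_norm_cart[of v] by metis+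
      then have "\<bar>v $ i\<bar> * (\<bar>gram x $ i $ k - gram x0 $ i $ k\<bar> * \<bar>v $ k\<bar>)
          \<le> 1 * (\<bar>gram x $ i $ k - gram x0 $ i $ k\<bar> * 1)"
        by (intro mult_mono) auto
      then show ?thesis by (simp add: abs_mult)
    qed
    have row: "\<bar>\<Sum>k\<in>UNIV. v $ i * ((gram x $ i $ k - gram x0 $ i $ k) * v $ k)\<bar>
        \<le> (\<Sum>k\<in>UNIV. \<bar>gram x $ i $ k - gram x0 $ i $ k\<bar>)" for i
      by (rule order_trans[OF sum_abs sum_mono]) (rule entry)
    have "v \<bullet> (gram x0 *v v) - v \<bullet> (gram x *v v) = - (v \<bullet> ((gram x - gram x0) *v v))"
      by (simp add: matrix_vector_mult_diff_rdistrib inner_diff_right)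
    also have "\<dots> = - (\<Sum>i\<in>UNIV. \<Sum>k\<in>UNIV. v $ i * ((gram x $ i $ k - gram x0 $ i $ k) * v $ k))"
      by (simp add: inner_vec_def matrix_vector_mult_def sum_distrib_left)
    also have "\<dots> \<le> \<bar>\<Sum>i\<in>UNIV. \<Sum>k\<in>UNIV. v $ i * ((gram x $ i $ k - gram x0 $ i $ k) * v $ k)\<bar>"
      by simp
    also have "\<dots> \<le> N x"
      unfolding N_def by (rule order_trans[OF sum_abs sum_mono]) (rule row)
    also have "\<dots> < e" using d(2)[of x] x by (simp add: dist_commute dist_real_def)
    also have "e \<le> v \<bullet> (gram x0 *v v)" unfolding e_def using v by (intro y0(2)) simp
    finally have "0 < v \<bullet> (gram x *v v)" by simp
    then have "0 < (norm y)\<^sup>2 * (v \<bullet> (gram x *v v))" using y by simp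
    moreover have "norm y *\<^sub>R v = y" using y by (simp add: v_def)
    then have "y \<bullet> (gram x *v y) = (norm y)\<^sup>2 * (v \<bullet> (gram x *v v))"
      by (metis inner_scaleR_left inner_scaleR_right matrix_vector_mult_scaleR mult.assoc power2_eq_square)
    ultimately show ?thesis by simp
  qed
  then have "regular x" if "x \<in> ball x0 d" for x using that unfolding regular_def by blast
  then show "\<exists>e>0. ball x0 e \<subseteq> {x. regular x}"
    using d(1) by blast
qed

lemma det_gram_nonzero:
  assumes "regular x" shows "det (gram x) \<noteq> 0"
proof -
  have "\<forall>y. gram x *v y = 0 \<longrightarrow> y = 0"
    using assms unfolding regular_def by (metis inner_zero_right less_irrefl)
  then show ?thesis
    by (metis invertible_det_nz invertible_left_inverse matrix_left_invertible_ker)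
qed

lemma transpose_gram: "transpose (gram x) = gram x"
  by (simp add: gram_def matrix_transpose_mul transpose_diag Qmat_def matrix_mul_assoc)

text \<open>
  At a solution of the normal equations the linear term of the quadratic objective vanishes.
\<close>

lemma ls_obj_expansion:
  assumes "gram x *v y = rhs \<sigma> x"
  shows "ls_obj f c l u \<omega> \<sigma> x (y + d) = ls_obj f c l u \<omega> \<sigma> x y + 1/2 * (d \<bullet> (gram x *v d))"
proof -
  let ?A = "Amat c x" and ?Q = "Qmat l u \<omega> x"
  define r where "r = ?A *v y - grad f x"
  define w where "w = ?A *v d"
  have Q: "transpose ?Q = ?Q" by (simp add: Qmat_def transpose_diag)
  have "transpose ?A *v (?Q *v r) = gram x *v y - transpose ?A *v (?Q *v grad f x)"
    by (simp only: r_def gram_def matrix_vector_mult_diff_distrib matrix_vector_mul_assoc matrix_mul_assoc)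
  also have "\<dots> = - (\<sigma> *\<^sub>R c x)" unfolding assms rhs_def by simp
  finally have nr: "transpose ?A *v (?Q *v r) = - (\<sigma> *\<^sub>R c x)" .
  have "w \<bullet> (?Q *v r) = d \<bullet> (transpose ?A *v (?Q *v r))"
    using inner_matrix_vector_transpose[of "?Q *v r" ?A d] by (simp add: w_def inner_commute)
  then have wr: "w \<bullet> (?Q *v r) = - \<sigma> * (c x \<bullet> d)" unfolding nr by (simp add: inner_commute)
  have rw: "r \<bullet> (?Q *v w) = w \<bullet> (?Q *v r)"
    using inner_symmetric_matrix[OF Q, of r w] by (simp add: inner_commute)
  have "d \<bullet> (gram x *v d) = d \<bullet> (transpose ?A *v (?Q *v w))"
    by (simp only: w_def gram_def matrix_vector_mul_assoc matrix_mul_assoc)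
  also have "\<dots> = w \<bullet> (?Q *v w)"
    using inner_matrix_vector_transpose[of "?Q *v w" ?A d] by (simp add: w_def inner_commute)
  finally have ww: "d \<bullet> (gram x *v d) = w \<bullet> (?Q *v w)" .
  have "?A *v (y + d) - grad f x = r + w"
    by (simp add: r_def w_def matrix_vector_right_distrib)
  then show ?thesis
    unfolding ls_obj_def Let_def r_def[symmetric] ww using wr rw
    by (simp add: matrix_vector_right_distrib inner_add_left inner_add_right field_simps)
qed

lemma ysol_unique:
  assumes reg: "regular x" and y: "gram x *v y = rhs \<sigma> x"
  shows "y_opt \<sigma> x = y"
proof -
  let ?J = "ls_obj f c l u \<omega> \<sigma> x"
  have exp: "?J y' = ?J y + 1/2 * ((y' - y) \<bullet> (gram x *v (y' - y)))" for y'
    using ls_obj_expansion[OF y, of "y' - y"] by simp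
  have less: "?J y < ?J y'" if "y' \<noteq> y" for y'
  proof -
    have "y' - y \<noteq> 0" using that by simp
    then have "0 < (y' - y) \<bullet> (gram x *v (y' - y))" using reg unfolding regular_def by blast
    then show ?thesis using exp[of y'] by linarith
  qed
  show ?thesis
    unfolding arg_min_def ysol_def
  proof (rule some_equality)
    show "is_arg_min ?J (\<lambda>_. True) y"
      unfolding is_arg_min_def using less by (metis less_irrefl less_asym)
    show "y' = y" if "is_arg_min ?J (\<lambda>_. True) y'" for y'
      using that less unfolding is_arg_min_def by blast
  qed
qed

lemma gram_ysol:
  assumes "regular x" shows "gram x *v y_opt \<sigma> x = rhs \<sigma> x"
proof -
  obtain y where y: "gram x *v y = rhs \<sigma> x" using cramer[OF det_gram_nonzero[OF assms]] by blast
  then show ?thesis using ysol_unique[OF assms] by blast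
qed

text \<open>
  Cramer's rule expresses the multipliers as quotients of determinants of continuously
  differentiable matrices.
\<close>

lemma C1_ysol: "C1_on {x. regular x} (\<lambda>x. y_opt \<sigma> x $ i)"
proof (rule C1_on_cong)
  let ?M = "\<lambda>x. (\<chi> a b. if b = i then rhs \<sigma> x $ a else gram x $ a $ b) :: real^'m^'m"
  have C1: "C1_on {x. regular x} (\<lambda>x. ?M x $ a $ b)" for a b
    using C1_on_subset[OF C1_gram] C1_on_subset[OF C1_rhs] by (cases "b = i") simp_all
  have C1': "C1_on {x. regular x} (\<lambda>x. gram x $ a $ b)" for a b
    using C1_on_subset[OF C1_gram] by simp
  show "C1_on {x. regular x} (\<lambda>x. det (?M x) / det (gram x))"
    by (rule C1_on_divide[OF C1_on_det[OF C1] C1_on_det[OF C1']]) (simp add: det_gram_nonzero)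
  show "y_opt \<sigma> x $ i = det (?M x) / det (gram x)" if "x \<in> {x. regular x}" for x
    using that cramer[OF det_gram_nonzero, of x "y_opt \<sigma> x" "rhs \<sigma> x"] gram_ysol[of x \<sigma>] by simp
qed (rule open_regular)

end

section \<open>Derivatives of the penalty function\<close>

lemma GDERIV_sum:
  assumes "\<And>i. i \<in> I \<Longrightarrow> GDERIV (h i) x :> D i"
  shows "GDERIV (\<lambda>x. \<Sum>i\<in>I. h i x) x :> (\<Sum>i\<in>I. D i)"
  using assms unfolding gderiv_def inner_sum_right by (intro has_derivative_sum)

lemma Amat_mult_vec: "Amat c x *v y = (\<Sum>i\<in>UNIV. y $ i *\<^sub>R grad (\<lambda>w. c w $ i) x)"
  by (simp add: vec_eq_iff matrix_vector_mult_def Amat_def mult.commute)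

lemma transpose_Amat_mult_vec: "(transpose (Amat c x) *v p) $ i = p \<bullet> grad (\<lambda>w. c w $ i) x"
  unfolding matrix_vector_mult_def by (simp add: transpose_def Amat_def inner_vec_def mult.commute)

lemma hess_L_mult_vec:
  fixes c :: "real^'a \<Rightarrow> real^'b"
  shows
  "hess_L f c x y *v p = hess f x *v p - (\<Sum>i\<in>UNIV. y $ i *\<^sub>R (hess (\<lambda>w. c w $ i) x *v p))"
proof -
  have "(\<Sum>i\<in>I. y $ i *\<^sub>R hess (\<lambda>w. c w $ i) x) *v p
      = (\<Sum>i\<in>I. y $ i *\<^sub>R (hess (\<lambda>w. c w $ i) x *v p))" if "finite I" for I :: "'b set"
    using that
    by (induction I) (simp_all add: matrix_vector_mult_add_rdistrib scaleR_matrix_vector_assoc)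
  then show ?thesis by (simp add: hess_L_def matrix_vector_mult_diff_rdistrib)
qed

context scaled_problem
begin

abbreviation Y :: "real \<Rightarrow> real^'n \<Rightarrow> real^'m^'n" where
  "Y \<equiv> Ymat f c l u \<omega>"

abbreviation \<phi> :: "real \<Rightarrow> real^'n \<Rightarrow> real" where
  "\<phi> \<equiv> phi f c l u \<omega>"

text \<open>
  The gradient of the Lagrangian at the multipliers of the penalty function, which is also the
  negative residual of the least squares problem.
\<close>

definition resid :: "real \<Rightarrow> real^'n \<Rightarrow> real^'n" where
  "resid \<sigma> x = grad f x - Amat c x *v y_opt \<sigma> x"

lemma normal_equations:
  assumes "regular x"
  shows "transpose (Amat c x) *v (Qmat l u \<omega> x *v resid \<sigma> x) = \<sigma> *\<^sub>R c x"
proof -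
  have "transpose (Amat c x) *v (Qmat l u \<omega> x *v resid \<sigma> x)
      = transpose (Amat c x) *v (Qmat l u \<omega> x *v grad f x) - gram x *v y_opt \<sigma> x"
    by (simp only: resid_def gram_def matrix_vector_mult_diff_distrib matrix_vector_mul_assoc matrix_mul_assoc)
  then show ?thesis unfolding gram_ysol[OF assms] rhs_def by simp
qed

lemma grad_f_derivative: "(grad f has_derivative (\<lambda>p. hess f x *v p)) (at x)"
  by (rule has_derivative_grad, rule C1_on_differentiable[OF C1_grad_f]) simp

lemma grad_c_derivative:
  "(grad (\<lambda>w. c w $ i) has_derivative (\<lambda>p. hess (\<lambda>w. c w $ i) x *v p)) (at x)"
  by (rule has_derivative_grad, rule C1_on_differentiable[OF Ck_2_imp_C1_on_grad[OF Ck_2_c]]) simp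

lemma GDERIV_c: "GDERIV (\<lambda>w. c w $ i) x :> grad (\<lambda>w. c w $ i) x"
  by (rule C1_on_GDERIV[OF C1_c]) simp

lemma GDERIV_ysol:
  assumes "regular x"
  shows "GDERIV (\<lambda>w. y_opt \<sigma> w $ i) x :> grad (\<lambda>w. y_opt \<sigma> w $ i) x"
  by (rule C1_on_GDERIV[OF C1_ysol]) (simp add: assms)

lemma Ymat_nth:
  assumes "regular x"
  shows "Y \<sigma> x $ j $ i = grad (\<lambda>w. y_opt \<sigma> w $ i) x $ j"
proof -
  let ?J = "jacobian (y_opt \<sigma>) (at x)"
  have "y_opt \<sigma> differentiable (at x)"
    by (rule differentiable_vecI, rule C1_on_differentiable[OF C1_ysol]) (simp add: assms)
  then have "(y_opt \<sigma> has_derivative (\<lambda>p. ?J *v p)) (at x)" by (simp only: jacobian_works)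
  then have 1: "((\<lambda>w. y_opt \<sigma> w $ i) has_derivative (\<lambda>p. (?J *v p) $ i)) (at x)"
    by (rule bounded_linear.has_derivative[OF bounded_linear_vec_nth])
  have "(\<lambda>p. (?J *v p) $ i) = (\<lambda>p. p \<bullet> grad (\<lambda>w. y_opt \<sigma> w $ i) x)"
    using 1 GDERIV_ysol[OF assms, of \<sigma> i] unfolding gderiv_def by (rule has_derivative_unique)
  then have "(?J *v axis j 1) $ i = axis j 1 \<bullet> grad (\<lambda>w. y_opt \<sigma> w $ i) x" by metis
  then show ?thesis
    by (simp add: Ymat_def transpose_def matrix_vector_mult_basis column_def inner_axis')
qed

lemma Ymat_mult_vec:
  assumes "regular x"
  shows "Y \<sigma> x *v w = (\<Sum>i\<in>UNIV. w $ i *\<^sub>R grad (\<lambda>w. y_opt \<sigma> w $ i) x)"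
  by (simp add: vec_eq_iff matrix_vector_mult_def Ymat_nth[OF assms] mult.commute)

lemma transpose_Ymat_mult_vec:
  assumes "regular x"
  shows "(transpose (Y \<sigma> x) *v p) $ i = p \<bullet> grad (\<lambda>w. y_opt \<sigma> w $ i) x"
  unfolding matrix_vector_mult_def
  by (simp add: transpose_def Ymat_nth[OF assms] inner_vec_def mult.commute)

text \<open>
  The product rule for \<open>c\<^sup>T y\<close>: the derivatives of \<open>c\<close> join \<open>grad f\<close> to form the residual.
\<close>

lemma GDERIV_phi:
  assumes "regular x"
  shows "GDERIV (\<phi> \<sigma>) x :> resid \<sigma> x - Y \<sigma> x *v c x"
proof -
  have "GDERIV (\<lambda>x. f x - (\<Sum>i\<in>UNIV. c x $ i * y_opt \<sigma> x $ i)) x :>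
      grad f x - (\<Sum>i\<in>UNIV. c x $ i *\<^sub>R grad (\<lambda>w. y_opt \<sigma> w $ i) x
                          + y_opt \<sigma> x $ i *\<^sub>R grad (\<lambda>w. c w $ i) x)"
    by (intro GDERIV_diff GDERIV_sum GDERIV_mult GDERIV_c GDERIV_ysol assms
        C1_on_GDERIV[OF C1_f]) simp
  moreover have "\<phi> \<sigma> = (\<lambda>x. f x - (\<Sum>i\<in>UNIV. c x $ i * y_opt \<sigma> x $ i))"
    by (simp add: fun_eq_iff phi_def inner_vec_def)
  ultimately show ?thesis
    by (simp add: resid_def Ymat_mult_vec[OF assms] Amat_mult_vec sum.distrib algebra_simps)
qed

lemma resid_derivative:
  assumes "regular x"
  shows "(resid \<sigma> has_derivative
    (\<lambda>p. hess_L f c x (y_opt \<sigma> x) *v p - Amat c x *v (transpose (Y \<sigma> x) *v p))) (at x)"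
proof -
  have "((\<lambda>x. grad f x - (\<Sum>i\<in>UNIV. y_opt \<sigma> x $ i *\<^sub>R grad (\<lambda>w. c w $ i) x)) has_derivative
      (\<lambda>p. hess f x *v p - (\<Sum>i\<in>UNIV. y_opt \<sigma> x $ i *\<^sub>R (hess (\<lambda>w. c w $ i) x *v p)
          + (p \<bullet> grad (\<lambda>w. y_opt \<sigma> w $ i) x) *\<^sub>R grad (\<lambda>w. c w $ i) x))) (at x)"
    using GDERIV_ysol[OF assms] unfolding gderiv_def
    by (intro has_derivative_diff has_derivative_sum has_derivative_scaleR grad_f_derivative
        grad_c_derivative)
  moreover have "resid \<sigma> = (\<lambda>x. grad f x - (\<Sum>i\<in>UNIV. y_opt \<sigma> x $ i *\<^sub>R grad (\<lambda>w. c w $ i) x))"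
    by (simp add: fun_eq_iff resid_def Amat_mult_vec)
  moreover have "hess_L f c x (y_opt \<sigma> x) *v p - Amat c x *v (transpose (Y \<sigma> x) *v p)
      = hess f x *v p - (\<Sum>i\<in>UNIV. y_opt \<sigma> x $ i *\<^sub>R (hess (\<lambda>w. c w $ i) x *v p)
          + (p \<bullet> grad (\<lambda>w. y_opt \<sigma> w $ i) x) *\<^sub>R grad (\<lambda>w. c w $ i) x)" for p
    unfolding hess_L_mult_vec Amat_mult_vec transpose_Ymat_mult_vec[OF assms]
    by (simp add: sum.distrib algebra_simps)
  ultimately show ?thesis by simp
qed

text \<open>
  Near \<open>x\<close> the gradient of \<open>\<phi>\<close> is \<open>r - Y c\<close>. The residual is differentiable since the multipliers are;
  the product \<open>Y c\<close> is differentiable at \<open>x\<close> because \<open>c\<close> vanishes there and \<open>Y\<close> is continuous.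
\<close>

lemma hess_phi_mult_vec:
  assumes reg: "regular x" and c: "c x = 0"
  shows "hess_phi f c l u \<omega> \<sigma> x *v p
    = hess_L f c x (y_opt \<sigma> x) *v p - Amat c x *v (transpose (Y \<sigma> x) *v p)
      - Y \<sigma> x *v (transpose (Amat c x) *v p)"
proof -
  have grad_phi: "grad (\<phi> \<sigma>) w
      = resid \<sigma> w - (\<Sum>i\<in>UNIV. c w $ i *\<^sub>R grad (\<lambda>w. y_opt \<sigma> w $ i) w)" if "regular w" for w
    using grad_eqI[OF GDERIV_phi[OF that]] Ymat_mult_vec[OF that] by simp
  have "isCont (grad (\<lambda>w. y_opt \<sigma> w $ i)) x" for i
    using C1_on_continuous_grad[OF C1_ysol, of \<sigma> i] open_regular reg
    by (simp add: continuous_on_eq_continuous_at)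
  then have "((\<lambda>w. c w $ i *\<^sub>R grad (\<lambda>w. y_opt \<sigma> w $ i) w) has_derivative
      (\<lambda>p. (p \<bullet> grad (\<lambda>w. c w $ i) x) *\<^sub>R grad (\<lambda>w. y_opt \<sigma> w $ i) x)) (at x)" for i
    using GDERIV_c[of i x] c unfolding gderiv_def by (intro has_derivative_scaleR_at_zero) auto
  then have "((\<lambda>w. resid \<sigma> w - (\<Sum>i\<in>UNIV. c w $ i *\<^sub>R grad (\<lambda>w. y_opt \<sigma> w $ i) w)) has_derivative
      (\<lambda>p. hess_L f c x (y_opt \<sigma> x) *v p - Amat c x *v (transpose (Y \<sigma> x) *v p)
      - (\<Sum>i\<in>UNIV. (p \<bullet> grad (\<lambda>w. c w $ i) x) *\<^sub>R grad (\<lambda>w. y_opt \<sigma> w $ i) x))) (at x)"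
    by (intro has_derivative_diff has_derivative_sum resid_derivative[OF reg])
  then have D: "(grad (\<phi> \<sigma>) has_derivative
      (\<lambda>p. hess_L f c x (y_opt \<sigma> x) *v p - Amat c x *v (transpose (Y \<sigma> x) *v p)
      - (\<Sum>i\<in>UNIV. (p \<bullet> grad (\<lambda>w. c w $ i) x) *\<^sub>R grad (\<lambda>w. y_opt \<sigma> w $ i) x))) (at x)"
    by (rule has_derivative_transform_within_open[OF _ open_regular]) (use reg grad_phi in auto)
  then have "grad (\<phi> \<sigma>) differentiable (at x)" by (rule differentiableI)
  then have "(grad (\<phi> \<sigma>) has_derivative (\<lambda>p. hess_phi f c l u \<omega> \<sigma> x *v p)) (at x)"
    by (simp only: hess_phi_def hess_def jacobian_works)
  from fun_cong[OF has_derivative_unique[OF this D], of p] show ?thesis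
    unfolding Ymat_mult_vec[OF reg] transpose_Amat_mult_vec .
qed

text \<open>
  The two cross terms are transposes of each other and therefore have the same quadratic form.
\<close>

lemma hess_phi_form:
  assumes reg: "regular x" and c: "c x = 0"
  shows "p \<bullet> (hess_phi f c l u \<omega> \<sigma> x *v p)
    = p \<bullet> (hess_L f c x (y_opt \<sigma> x) *v p) - 2 * (p \<bullet> (Amat c x *v (transpose (Y \<sigma> x) *v p)))"
proof -
  have "p \<bullet> (Y \<sigma> x *v (transpose (Amat c x) *v p)) = p \<bullet> (Amat c x *v (transpose (Y \<sigma> x) *v p))"
    unfolding inner_matrix_vector_transpose[of p] by (rule inner_commute)
  then show ?thesis unfolding hess_phi_mult_vec[OF assms] by (simp add: inner_diff_right)
qed

lemma qvec_derivative: "\<exists>k. ((\<lambda>x. qvec l u \<omega> x $ j) has_derivative (\<lambda>p. k * p $ j)) (at x)"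
proof -
  obtain q' where "\<And>t. (qscale (l $ j) (u $ j) (\<omega> $ j) has_real_derivative q' t) (at t)"
    using qscale_C1[of "\<omega> $ j" "u $ j" "l $ j"] omega bounds by blast
  then have "(qscale (l $ j) (u $ j) (\<omega> $ j) has_derivative (\<lambda>t. q' (x $ j) * t)) (at (x $ j))"
    by (simp only: has_field_derivative_def)
  from has_derivative_compose[OF bounded_linear_imp_has_derivative[OF bounded_linear_vec_nth] this]
  show ?thesis unfolding qvec_def vec_lambda_beta by (rule exI)
qed

text \<open>
  Differentiating \<open>A\<^sup>T Q r = \<sigma> c\<close> along \<open>p\<close> produces three terms on the left. The one with the derivative
  of \<open>A\<close> contains \<open>Q r = 0\<close>; the one with the derivative of \<open>Q\<close> has entries proportional to
  \<open>p\<^sub>j r\<^sub>j = 0\<close>, as \<open>q\<^sub>j\<close> depends on the \<open>j\<close>-th coordinate alone. Only the derivative of \<open>r\<close> remains.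
\<close>

lemma normal_equations_derivative:
  assumes reg: "regular x"
    and qr: "\<And>j. qvec l u \<omega> x $ j * resid \<sigma> x $ j = 0" and pr: "\<And>j. p $ j * resid \<sigma> x $ j = 0"
  shows "transpose (Amat c x) *v (Qmat l u \<omega> x *v
      (hess_L f c x (y_opt \<sigma> x) *v p - Amat c x *v (transpose (Y \<sigma> x) *v p)))
    = \<sigma> *\<^sub>R (transpose (Amat c x) *v p)"
proof -
  let ?r' = "\<lambda>p. hess_L f c x (y_opt \<sigma> x) *v p - Amat c x *v (transpose (Y \<sigma> x) *v p)"
  let ?q = "qvec l u \<omega>"
  have mult: "(transpose (Amat c x) *v (Qmat l u \<omega> x *v w)) $ i
      = (\<Sum>j\<in>UNIV. Amat c x $ j $ i * (?q x $ j * w $ j))" for w x i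
    unfolding matrix_vector_mult_def[of "transpose _"]
    by (simp add: transpose_def Qmat_def diag_mult_vec)
  have "\<forall>j. \<exists>k. ((\<lambda>x. ?q x $ j) has_derivative (\<lambda>p. k * p $ j)) (at x)"
    by (rule allI, rule qvec_derivative)
  then have "\<exists>k. \<forall>j. ((\<lambda>x. ?q x $ j) has_derivative (\<lambda>p. k j * p $ j)) (at x)"
    by (rule choice)
  then obtain k where k: "\<And>j. ((\<lambda>x. ?q x $ j) has_derivative (\<lambda>p. k j * p $ j)) (at x)"
    by blast
  have r: "((\<lambda>x. resid \<sigma> x $ j) has_derivative (\<lambda>p. ?r' p $ j)) (at x)" for j
    using resid_derivative[OF reg] by (rule bounded_linear.has_derivative[OF bounded_linear_vec_nth])
  have A: "((\<lambda>x. Amat c x $ j $ i) has_derivative (\<lambda>p. p \<bullet> grad (\<lambda>x. Amat c x $ j $ i) x)) (at x)" for i j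
    using C1_on_GDERIV[OF C1_Amat, of x j i] unfolding gderiv_def by simp
  have "(\<Sum>j\<in>UNIV. Amat c x $ j $ i * (?q x $ j * ?r' p $ j)) = \<sigma> * (p \<bullet> grad (\<lambda>w. c w $ i) x)" for i
  proof -
    have "((\<lambda>x. \<Sum>j\<in>UNIV. Amat c x $ j $ i * (?q x $ j * resid \<sigma> x $ j)) has_derivative
        (\<lambda>p. \<Sum>j\<in>UNIV. Amat c x $ j $ i * (?q x $ j * ?r' p $ j + (k j * p $ j) * resid \<sigma> x $ j)
          + (p \<bullet> grad (\<lambda>x. Amat c x $ j $ i) x) * (?q x $ j * resid \<sigma> x $ j))) (at x)"
      by (intro has_derivative_sum has_derivative_mult A k r)
    moreover have "((\<lambda>x. \<Sum>j\<in>UNIV. Amat c x $ j $ i * (?q x $ j * resid \<sigma> x $ j)) has_derivative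
        (\<lambda>p. \<sigma> * (p \<bullet> grad (\<lambda>w. c w $ i) x))) (at x)"
    proof (rule has_derivative_transform_within_open[OF _ open_regular])
      show "((\<lambda>x. \<sigma> * c x $ i) has_derivative (\<lambda>p. \<sigma> * (p \<bullet> grad (\<lambda>w. c w $ i) x))) (at x)"
        using GDERIV_c[of i x] unfolding gderiv_def by (rule has_derivative_mult_right)
      show "\<sigma> * c w $ i = (\<Sum>j\<in>UNIV. Amat c w $ j $ i * (?q w $ j * resid \<sigma> w $ j))"
        if "w \<in> {x. regular x}" for w
        using normal_equations[of w \<sigma>] that unfolding mult[symmetric] by simp
    qed (use reg in simp)
    ultimately have "(\<lambda>p. \<Sum>j\<in>UNIV. Amat c x $ j $ i * (?q x $ j * ?r' p $ j + (k j * p $ j) * resid \<sigma> x $ j)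
          + (p \<bullet> grad (\<lambda>x. Amat c x $ j $ i) x) * (?q x $ j * resid \<sigma> x $ j))
        = (\<lambda>p. \<sigma> * (p \<bullet> grad (\<lambda>w. c w $ i) x))"
      by (rule has_derivative_unique)
    from fun_cong[OF this, of p] show ?thesis
      unfolding mult.assoc[of "k _"] pr qr by simp
  qed
  then have "(transpose (Amat c x) *v (Qmat l u \<omega> x *v ?r' p)) $ i
      = (\<sigma> *\<^sub>R (transpose (Amat c x) *v p)) $ i" for i
    unfolding mult vector_scaleR_component transpose_Amat_mult_vec[of c x p] real_scaleR_def .
  then show ?thesis unfolding vec_eq_iff by (rule allI)
qed

end

section \<open>Stationary points\<close>

context scaled_problem
begin

lemma qvec_active: "j \<in> active l u x \<Longrightarrow> qvec l u \<omega> x $ j = 0"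
  using qscale_at_bound[of "\<omega> $ j" "u $ j" "l $ j" "x $ j"] omega bounds
  by (auto simp: active_def qvec_def)

lemma qvec_inactive:
  assumes "in_box l u x" "j \<notin> active l u x"
  shows "0 < qvec l u \<omega> x $ j"
proof -
  have "l $ j < ereal (x $ j)" "ereal (x $ j) < u $ j"
    using assms by (auto simp: in_box_def active_def less_le)
  then show ?thesis using qscale_pos[of "\<omega> $ j" "u $ j" "l $ j" "x $ j"] omega by (simp add: qvec_def)
qed

lemma qvec_nonneg: "in_box l u x \<Longrightarrow> 0 \<le> qvec l u \<omega> x $ j"
  using qvec_active[of j x] qvec_inactive[of x j] by (cases "j \<in> active l u x") auto

lemma Qhalf_square: "in_box l u x \<Longrightarrow> Qhalf l u \<omega> x *v (Qhalf l u \<omega> x *v v) = Qmat l u \<omega> x *v v"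
  by (simp add: vec_eq_iff Qhalf_def Qmat_def diag_mult_vec qvec_nonneg mult.assoc[symmetric])

lemma transpose_Qhalf: "transpose (Qhalf l u \<omega> x) = Qhalf l u \<omega> x"
  by (simp add: Qhalf_def transpose_diag)

lemma AQ_mult_vec: "AQ c l u \<omega> x *v y = Qhalf l u \<omega> x *v (Amat c x *v y)"
  by (simp only: AQ_def matrix_vector_mul_assoc)

lemma transpose_AQ_mult_vec:
  "transpose (AQ c l u \<omega> x) *v v = transpose (Amat c x) *v (Qhalf l u \<omega> x *v v)"
  by (simp only: AQ_def matrix_transpose_mul transpose_Qhalf matrix_vector_mul_assoc)

text \<open>
  Within the box \<open>gram x\<close> is the Gram matrix of \<open>AQ\<close>.
\<close>

lemma regularI:
  assumes box: "in_box l u x" and inj: "inj ((*v) (AQ c l u \<omega> x))"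
  shows "regular x"
  unfolding regular_def
proof (intro allI impI)
  fix y :: "real^'m" assume "y \<noteq> 0"
  then have "0 < (AQ c l u \<omega> x *v y) \<bullet> (AQ c l u \<omega> x *v y)" using inj unfolding inj_matrix_vector_mult_iff by auto
  also have "(AQ c l u \<omega> x *v y) \<bullet> (AQ c l u \<omega> x *v y)
      = y \<bullet> (transpose (AQ c l u \<omega> x) *v (AQ c l u \<omega> x *v y))"
    unfolding inner_matrix_vector_transpose[of y] transpose_transpose by (rule refl)
  also have "transpose (AQ c l u \<omega> x) *v (AQ c l u \<omega> x *v y) = gram x *v y"
    unfolding transpose_AQ_mult_vec AQ_mult_vec Qhalf_square[OF box]
    by (simp only: gram_def matrix_vector_mul_assoc matrix_mul_assoc)
  finally show "0 < y \<bullet> (gram x *v y)" .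
qed

lemma Qmat_mult_multiplier:
  assumes "kkt_PP f c l u \<omega> \<sigma> x z"
  shows "qvec l u \<omega> x $ j * z $ j = 0"
  using assms qvec_active[of j x] by (cases "j \<in> active l u x") (auto simp: kkt_PP_def)

text \<open>
  Since \<open>Q z = 0\<close>, the normal equations at a stationary point of the penalty function read
  \<open>\<sigma> c = A\<^sup>T Q Y c\<close>, and a matrix with norm below \<open>\<sigma>\<close> has no eigenvector to the eigenvalue \<open>\<sigma>\<close>.
\<close>

lemma kkt_PP_feasible:
  assumes kkt: "kkt_PP f c l u \<omega> \<sigma> x z" and reg: "regular x"
    and large: "\<sigma> > norm2 (transpose (Amat c x) ** Qmat l u \<omega> x ** Y \<sigma> x)"
  shows "c x = 0"
proof (rule ccontr)
  assume ne: "c x \<noteq> 0"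
  let ?M = "transpose (Amat c x) ** Qmat l u \<omega> x ** Y \<sigma> x"
  have "z = resid \<sigma> x - Y \<sigma> x *v c x"
    using GDERIV_unique[OF _ GDERIV_phi[OF reg, of \<sigma>], of z] kkt by (simp add: kkt_PP_def)
  then have r: "resid \<sigma> x = z + Y \<sigma> x *v c x" by simp
  have "Qmat l u \<omega> x *v z = 0"
    using Qmat_mult_multiplier[OF kkt] by (simp add: vec_eq_iff Qmat_def diag_mult_vec)
  then have "transpose (Amat c x) *v (Qmat l u \<omega> x *v resid \<sigma> x) = ?M *v c x"
    unfolding r matrix_vector_right_distrib by (simp add: matrix_vector_mul_assoc matrix_mul_assoc)
  then have "\<sigma> *\<^sub>R c x = ?M *v c x" using normal_equations[OF reg] by simp
  then have "\<bar>\<sigma>\<bar> * norm (c x) = norm (?M *v c x)" by (metis norm_scaleR)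
  also have "\<dots> \<le> norm2 ?M * norm (c x)"
    unfolding norm2_def by (rule onorm[OF matrix_vector_mul_bounded_linear])
  finally have "\<bar>\<sigma>\<bar> \<le> norm2 ?M" using ne by simp
  then show False using large by simp
qed

lemma ysol_feasible:
  assumes "regular x" "c x = 0" shows "y_opt \<sigma> x = y_opt \<tau> x"
proof (rule ysol_unique[OF assms(1)])
  show "gram x *v y_opt \<tau> x = rhs \<sigma> x" using gram_ysol[OF assms(1)] assms(2) by (simp add: rhs_def)
qed

text \<open>
  At a feasible point the multipliers, and with them the gradient of \<open>\<phi>\<close>, are the same for all \<open>\<sigma>\<close>.
\<close>

lemma kkt_PP_feasible_imp_kkt_NP:
  assumes kkt: "kkt_PP f c l u \<omega> \<sigma> x z" and reg: "regular x" and c: "c x = 0"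
  shows "kkt_NP f c l u \<omega> x z"
proof -
  have "GDERIV (\<phi> \<tau>) x :> z" for \<tau>
  proof -
    have "z = resid \<sigma> x"
      using GDERIV_unique[OF _ GDERIV_phi[OF reg, of \<sigma>], of z] kkt c by (simp add: kkt_PP_def)
    also have "\<dots> = resid \<tau> x" unfolding resid_def ysol_feasible[OF reg c, of \<sigma> \<tau>] ..
    finally show ?thesis using GDERIV_phi[OF reg, of \<tau>] c by simp
  qed
  then show ?thesis using kkt c by (simp add: kkt_NP_def kkt_PP_def)
qed

text \<open>
  If \<open>Q\<^sup>1\<^sup>/\<^sup>2 A y = 0\<close>, then \<open>A y\<close> is supported on the active bounds, where \<open>Q\<close> vanishes. So \<open>A y\<close> is at
  once a combination of constraint gradients and of the unit vectors of active bounds, and linear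
  independence leaves only \<open>y = 0\<close>.
\<close>

lemma licq_imp_AQ_injective:
  assumes box: "in_box l u x" and licq: "licq c l u x"
  shows "inj ((*v) (AQ c l u \<omega> x))"
  unfolding inj_matrix_vector_mult_iff
proof (intro allI impI)
  fix y assume zero: "AQ c l u \<omega> x *v y = 0"
  define K :: "('m + 'n) set" where "K = range Inl \<union> Inr ` active l u x"
  let ?n = "constraint_normal c x"
  \<comment> \<open>The coefficients of the vanishing combination \<open>A y - (A y)\<close> of constraint normals.\<close>
  define a where "a k = (case k of Inl i \<Rightarrow> y $ i | Inr j \<Rightarrow> - (Amat c x *v y) $ j)" for k
  have inj: "inj_on ?n K" and ind: "independent (?n ` K)"
    using licq by (simp_all add: licq_def Let_def K_def)
  have inactive: "(Amat c x *v y) $ j = 0" if "j \<notin> active l u x" for j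
  proof -
    have "sqrt (qvec l u \<omega> x $ j) * (Amat c x *v y) $ j = (AQ c l u \<omega> x *v y) $ j"
      by (simp add: AQ_mult_vec Qhalf_def diag_mult_vec)
    then show ?thesis using zero qvec_inactive[OF box that] by simp
  qed
  have "(\<Sum>k\<in>K. a k *\<^sub>R ?n k)
      = (\<Sum>k\<in>range Inl. a k *\<^sub>R ?n k) + (\<Sum>k\<in>Inr ` active l u x. a k *\<^sub>R ?n k)"
    unfolding K_def by (intro sum.union_disjoint) auto
  also have "(\<Sum>k\<in>range Inl. a k *\<^sub>R ?n k) = Amat c x *v y"
    by (subst sum.reindex) (auto simp: inj_on_def a_def constraint_normal_def Amat_mult_vec)
  also have "(\<Sum>k\<in>Inr ` active l u x. a k *\<^sub>R ?n k)
      = (\<Sum>j\<in>active l u x. - (Amat c x *v y) $ j *\<^sub>R axis j 1)"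
    by (subst sum.reindex) (auto simp: inj_on_def a_def constraint_normal_def)
  also have "\<dots> = (\<Sum>j\<in>UNIV. - (Amat c x *v y) $ j *\<^sub>R axis j 1)"
    by (rule sum.mono_neutral_left) (auto simp: inactive)
  also have "\<dots> = - (\<Sum>j\<in>UNIV. (Amat c x *v y) $ j *s axis j 1)"
    by (simp add: sum_negf scalar_mult_eq_scaleR)
  also have "\<dots> = - (Amat c x *v y)" unfolding basis_expansion ..
  finally have "(\<Sum>k\<in>K. a k *\<^sub>R ?n k) = 0" by simp
  \<comment> \<open>Linear independence is a statement about the set of vectors, so the coefficients are carried over
    along the inverse of the injective map from indices to normals.\<close>
  then have sum0: "(\<Sum>v\<in>?n ` K. a (the_inv_into K ?n v) *\<^sub>R v) = 0"
    by (simp add: sum.reindex[OF inj] the_inv_into_f_f[OF inj])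
  have "a k = 0" if "k \<in> K" for k
  proof -
    have "a (the_inv_into K ?n (?n k)) = 0"
      using independentD[OF ind _ subset_refl sum0] that by simp
    then show ?thesis using the_inv_into_f_f[OF inj that] by simp
  qed
  then have "a (Inl i) = 0" for i by (simp add: K_def)
  then show "y = 0" by (simp add: a_def vec_eq_iff)
qed

end

section \<open>Second-order conditions\<close>

context scaled_problem
begin

text \<open>
  Here the substitution \<open>p = D v\<close> with \<open>D = Q\<^sup>1\<^sup>/\<^sup>2\<close> is carried out. Its image is the set \<open>T\<close> of vectors
  that vanish at active bounds, which is the critical cone of the penalty problem by strict
  complementarity; \<open>D\<close> maps \<open>T\<close> bijectively to itself, and \<open>T\<close> contains the range of \<open>P\<close>. A vector
  \<open>v - P v\<close> is orthogonal to the columns of \<open>AQ\<close>, so \<open>D (v - P v)\<close> satisfies \<open>A\<^sup>T p = 0\<close> and lies in the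
  critical cone of the original problem.
\<close>

lemma second_order_conditions:
  assumes kkt: "kkt_NP_mult f c l u \<omega> x y z" and licq: "licq c l u x"
    and strict: "\<And>j. z $ j \<noteq> 0 \<longleftrightarrow> j \<in> active l u x"
    and sigma: "0 < \<sigma>"
    and nonneg: "\<forall>p\<in>cone_NP c l u x z. 0 \<le> p \<bullet> (hess_phi f c l u \<omega> \<sigma> x *v p)"
  shows "(\<forall>p\<in>cone_phi l u x z. p \<bullet> (hess_phi f c l u \<omega> \<sigma> x *v p) \<ge> 0)
      \<longleftrightarrow> \<sigma> \<ge> sigma_bar f c l u \<omega> x y"
    and "(\<forall>p\<in>cone_NP c l u x z. p \<noteq> 0 \<longrightarrow> 0 < p \<bullet> (hess_phi f c l u \<omega> \<sigma> x *v p)) \<Longrightarrow>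
      (\<forall>p\<in>cone_phi l u x z. p \<noteq> 0 \<longrightarrow> p \<bullet> (hess_phi f c l u \<omega> \<sigma> x *v p) > 0)
      \<longleftrightarrow> \<sigma> > sigma_bar f c l u \<omega> x y"
proof -
  have PP: "kkt_PP f c l u \<omega> \<sigma> x z" and c: "c x = 0" and y: "y = y_opt \<sigma> x"
    using kkt sigma by (auto simp: kkt_NP_mult_def kkt_NP_def)
  have box: "in_box l u x" using PP by (simp add: kkt_PP_def)
  note inj = licq_imp_AQ_injective[OF box licq]
  have reg: "regular x" using box inj by (rule regularI)
  define D where "D = Qhalf l u \<omega> x"
  define A where "A = Amat c x"
  define H where "H = hess_L f c x y"
  define B where "B = D ** H ** D"
  define P where "P = Pmat c l u \<omega> x"
  define T where "T = {v::real^'n. \<forall>j\<in>active l u x. v $ j = 0}"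
  let ?form = "\<lambda>p. p \<bullet> (hess_phi f c l u \<omega> \<sigma> x *v p)"
  let ?split = "\<lambda>v. (v - P *v v) \<bullet> (B *v (v - P *v v)) - (P *v v) \<bullet> (B *v (P *v v))
    + 2 * \<sigma> * ((P *v v) \<bullet> (P *v v))"
  have r: "resid \<sigma> x = z"
    using GDERIV_unique[OF _ GDERIV_phi[OF reg, of \<sigma>], of z] PP c by (simp add: kkt_PP_def)
  have cone: "cone_phi l u x z = T"
    using strict by (auto simp: cone_phi_def T_def active_def)
  have Dv: "(D *v v) $ j = sqrt (qvec l u \<omega> x $ j) * v $ j" for v j
    by (simp add: D_def Qhalf_def diag_mult_vec)
  have D_T: "D *v v \<in> T" for v
    by (simp add: T_def Dv qvec_active)
  have D_surj: "\<exists>v\<in>T. D *v v = p" if "p \<in> T" for p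
  proof (intro bexI)
    let ?v = "\<chi> j. p $ j / sqrt (qvec l u \<omega> x $ j)"
    have "(D *v ?v) $ j = p $ j" for j
      using that qvec_inactive[OF box, of j] qvec_active[of j x]
      by (cases "j \<in> active l u x") (auto simp: Dv T_def)
    then show "D *v ?v = p" by (simp add: vec_eq_iff)
    show "?v \<in> T" using that by (simp add: T_def)
  qed
  have D_inj: "v = 0" if "v \<in> T" "D *v v = 0" for v
  proof -
    have prod: "sqrt (qvec l u \<omega> x $ j) * v $ j = 0" for j using that(2) Dv[of v j] by simp
    have "v $ j = 0" for j
      using that(1) prod[of j] qvec_inactive[OF box, of j] by (cases "j \<in> active l u x") (auto simp: T_def)
    then show ?thesis by (simp add: vec_eq_iff)
  qed
  have "transpose (\<Sum>i\<in>I. y $ i *\<^sub>R hess (\<lambda>w. c w $ i) x) = (\<Sum>i\<in>I. y $ i *\<^sub>R hess (\<lambda>w. c w $ i) x)"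
    if "finite I" for I :: "'m set"
    using transpose_hess[OF Ck_2_c, of _ x] by (auto simp: vec_eq_iff transpose_def)
  then have H_sym: "transpose H = H"
    using transpose_hess[OF Ck_2_f, of x] unfolding H_def hess_L_def
    by (auto simp: vec_eq_iff transpose_def)
  have D_sym: "transpose D = D" by (simp add: D_def transpose_Qhalf)
  have B_sym: "transpose B = B" by (simp add: B_def matrix_transpose_mul H_sym D_sym matrix_mul_assoc)
  note P = range_projector[of "AQ c l u \<omega> x", OF inj, folded Pmat_def, folded P_def]
  have form_split: "?form (D *v v) = ?split v" for v
  proof -
    define \<eta> where "\<eta> = transpose (Y \<sigma> x) *v (D *v v)"
    have qr: "qvec l u \<omega> x $ j * resid \<sigma> x $ j = 0" for j
      unfolding r by (rule Qmat_mult_multiplier[OF PP])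
    have pr: "(D *v v) $ j * resid \<sigma> x $ j = 0" for j
      using strict[of j] qvec_active[of j x] unfolding r Dv by auto
    have "transpose A *v (Qmat l u \<omega> x *v (H *v (D *v v) - A *v \<eta>)) = \<sigma> *\<^sub>R (transpose A *v (D *v v))"
      using normal_equations_derivative[OF reg qr pr] unfolding A_def H_def \<eta>_def y .
    then have "transpose A *v (D *v (B *v v)) - transpose A *v (D *v (D *v (A *v \<eta>)))
        = \<sigma> *\<^sub>R (transpose A *v (D *v v))"
      unfolding Qhalf_square[OF box, folded D_def, symmetric]
      by (simp only: B_def matrix_vector_mult_diff_distrib matrix_vector_mul_assoc matrix_mul_assoc)
    then have "transpose (AQ c l u \<omega> x) *v (AQ c l u \<omega> x *v \<eta>)
        = transpose (AQ c l u \<omega> x) *v (B *v v - \<sigma> *\<^sub>R v)"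
      unfolding transpose_AQ_mult_vec AQ_mult_vec D_def[symmetric] A_def[symmetric]
        matrix_vector_mult_diff_distrib matrix_vector_mult_scaleR
      by (simp only: diff_eq_eq eq_diff_eq add.commute)
    from quadratic_form_split[OF inj B_sym this, folded Pmat_def, folded P_def]
    have "v \<bullet> (B *v v) - 2 * (v \<bullet> (AQ c l u \<omega> x *v \<eta>)) = ?split v" .
    moreover have "(D *v v) \<bullet> (H *v (D *v v)) = v \<bullet> (B *v v)"
      using inner_symmetric_matrix[OF D_sym, of v "H *v (D *v v)"]
      by (simp add: B_def matrix_vector_mul_assoc[symmetric])
    moreover have "(D *v v) \<bullet> (A *v \<eta>) = v \<bullet> (AQ c l u \<omega> x *v \<eta>)"
      using inner_symmetric_matrix[OF D_sym, of v "A *v \<eta>"]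
      by (simp add: AQ_mult_vec D_def A_def)
    ultimately show ?thesis
      using hess_phi_form[OF reg c, of "D *v v" \<sigma>] unfolding A_def H_def \<eta>_def y by simp
  qed
  have P_T: "P *v v \<in> T" for v
  proof -
    obtain y where "P *v v = AQ c l u \<omega> x *v y" using P(4)[of v] by blast
    then show ?thesis using D_T by (simp add: AQ_mult_vec D_def)
  qed
  have ker_cone: "D *v (v - P *v v) \<in> cone_NP c l u x z" for v
  proof -
    have "transpose (Amat c x) *v (D *v (v - P *v v)) = transpose (AQ c l u \<omega> x) *v (v - P *v v)"
      by (simp only: transpose_AQ_mult_vec D_def)
    also have "\<dots> = 0"
      using P(3)[of v] by (simp only: matrix_vector_mult_diff_distrib right_minus_eq)
    finally show ?thesis using D_T by (simp add: cone_NP_def cone)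
  qed
  have ker_form: "?form (D *v (v - P *v v)) = (v - P *v v) \<bullet> (B *v (v - P *v v))" for v
  proof -
    have "P *v (v - P *v v) = 0" using P(2)[of v] by (simp only: matrix_vector_mult_diff_distrib right_minus_eq)
    then show ?thesis unfolding form_split by simp
  qed
  have sbar: "sigma_bar f c l u \<omega> x y = 1/2 * lambda_max (P ** B ** P)"
    by (simp add: sigma_bar_def P_def B_def D_def H_def matrix_mul_assoc)
  have "(\<forall>p\<in>T. 0 \<le> ?form p) \<longleftrightarrow> (\<forall>v\<in>T. 0 \<le> ?split v)"
  proof (intro iffI ballI)
    fix v assume "\<forall>p\<in>T. 0 \<le> ?form p"
    then have "0 \<le> ?form (D *v v)" using D_T by (rule bspec)
    then show "0 \<le> ?split v" unfolding form_split .
  next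
    fix p assume *: "\<forall>v\<in>T. 0 \<le> ?split v" and "p \<in> T"
    then obtain v where v: "v \<in> T" "D *v v = p" using D_surj by blast
    have "0 \<le> ?split v" using * v(1) by (rule bspec)
    then show "0 \<le> ?form p" unfolding form_split[symmetric] v(2) .
  qed
  also have "\<dots> \<longleftrightarrow> \<sigma> \<ge> 1/2 * lambda_max (P ** B ** P)"
    using bspec[OF nonneg ker_cone] unfolding ker_form
    by (intro split_form_nonneg_iff[OF B_sym P(1,2) sigma P_T])
  finally show "(\<forall>p\<in>cone_phi l u x z. 0 \<le> ?form p) \<longleftrightarrow> \<sigma> \<ge> sigma_bar f c l u \<omega> x y"
    unfolding cone sbar .
  assume pos: "\<forall>p\<in>cone_NP c l u x z. p \<noteq> 0 \<longrightarrow> 0 < ?form p"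
  have ker_pos: "0 < (v - P *v v) \<bullet> (B *v (v - P *v v))" if "v \<in> T" "v - P *v v \<noteq> 0" for v
  proof -
    have "v - P *v v \<in> T" using that(1) P_T[of v] by (simp add: T_def)
    then have "D *v (v - P *v v) \<noteq> 0" using D_inj that(2) by blast
    then have "0 < ?form (D *v (v - P *v v))" using pos ker_cone by blast
    then show ?thesis unfolding ker_form .
  qed
  have "(\<forall>p\<in>T. p \<noteq> 0 \<longrightarrow> 0 < ?form p) \<longleftrightarrow> (\<forall>v\<in>T. v \<noteq> 0 \<longrightarrow> 0 < ?split v)"
  proof (intro iffI ballI impI)
    fix v assume *: "\<forall>p\<in>T. p \<noteq> 0 \<longrightarrow> 0 < ?form p" and "v \<in> T" "v \<noteq> 0"
    then have "D *v v \<noteq> 0" using D_inj by blast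
    then have "0 < ?form (D *v v)" using bspec[OF * D_T] by (rule mp[rotated])
    then show "0 < ?split v" unfolding form_split .
  next
    fix p assume *: "\<forall>v\<in>T. v \<noteq> 0 \<longrightarrow> 0 < ?split v" and "p \<in> T" "p \<noteq> 0"
    then obtain v where v: "v \<in> T" "D *v v = p" using D_surj by blast
    then have "v \<noteq> 0" using \<open>p \<noteq> 0\<close> by auto
    then have "0 < ?split v" using bspec[OF * v(1)] by (rule mp[rotated])
    then show "0 < ?form p" unfolding form_split[symmetric] v(2) .
  qed
  also have "\<dots> \<longleftrightarrow> \<sigma> > 1/2 * lambda_max (P ** B ** P)"
    using ker_pos by (intro split_form_pos_iff[OF B_sym P(1,2) sigma P_T])
  finally show "(\<forall>p\<in>cone_phi l u x z. p \<noteq> 0 \<longrightarrow> 0 < ?form p) \<longleftrightarrow> \<sigma> > sigma_bar f c l u \<omega> x y"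
    unfolding cone sbar .
qed

end

lemma min_slack_eq_0_iff:
  assumes "a \<le> ereal t" "ereal t \<le> b"
  shows "min (ereal t - a) (b - ereal t) = 0 \<longleftrightarrow> ereal t = a \<or> ereal t = b"
  using assms by (cases a; cases b) (auto simp: min_def)

theorem theorem6:
  fixes f :: "real^'n \<Rightarrow> real"
    and c :: "real^'n \<Rightarrow> real^'m"
    and l u :: "ereal^'n"
    and \<omega> :: "real^'n"
    and \<sigma> :: real
    and xbar zbar xs zs :: "real^'n"
    and ys :: "real^'m"
  assumes dims: "CARD('m) \<le> CARD('n)"
    and omega: "\<And>j. 0 < \<omega> $ j \<and> ereal (\<omega> $ j) < u $ j - l $ j"
    and A1: "Ck 3 f" "Ck 3 c"
    and A2_stationary: "\<And>x y z. kkt_NP_mult f c l u \<omega> x y z \<Longrightarrow> licq c l u x"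
    and A2_interior: "\<And>x. (\<forall>j. l $ j < ereal (x $ j) \<and> ereal (x $ j) < u $ j) \<Longrightarrow> licq c l u x"
    and A3: "\<And>x y z j. kkt_NP_mult f c l u \<omega> x y z \<Longrightarrow>
               (z $ j = 0) \<noteq> (min (ereal (x $ j) - l $ j) (u $ j - ereal (x $ j)) = 0)"
    and A4_feasible: "\<exists>x. in_box l u x \<and> c x = 0"
    and A4_bounds: "\<And>j. l $ j < u $ j"
    and sigma: "0 < \<sigma>"
    and xbar: "kkt_PP f c l u \<omega> \<sigma> xbar zbar"
    and xbar_rank: "rank (Qhalf l u \<omega> xbar ** Amat c xbar) = CARD('m)"
    and xs: "second_order_necessary f c l u \<omega> xs ys zs"
  shows
    "(\<sigma> > norm2 (transpose (Amat c xbar) ** Qmat l u \<omega> xbar ** Ymat f c l u \<omega> \<sigma> xbar)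
        \<longrightarrow> c xbar = 0 \<and> kkt_NP f c l u \<omega> xbar zbar)
     \<and> ((\<forall>p\<in>cone_phi l u xs zs. p \<bullet> (hess_phi f c l u \<omega> \<sigma> xs *v p) \<ge> 0)
          \<longleftrightarrow> \<sigma> \<ge> sigma_bar f c l u \<omega> xs ys)
     \<and> (second_order_sufficient f c l u \<omega> xs ys zs \<longrightarrow>
          ((\<forall>p\<in>cone_phi l u xs zs. p \<noteq> 0 \<longrightarrow> p \<bullet> (hess_phi f c l u \<omega> \<sigma> xs *v p) > 0)
             \<longleftrightarrow> \<sigma> > sigma_bar f c l u \<omega> xs ys))"
proof -
  interpret scaled_problem f c l u \<omega>
    using omega A4_bounds A1 by unfold_locales
  have bar_box: "in_box l u xbar" using xbar by (simp add: kkt_PP_def)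
  have "inj ((*v) (AQ c l u \<omega> xbar))"
    using xbar_rank unfolding AQ_def full_rank_injective[symmetric] .
  then have bar_reg: "regular xbar"
    by (rule regularI[OF bar_box])
  have mult: "kkt_NP_mult f c l u \<omega> xs ys zs"
    using xs by (simp add: second_order_necessary_def)
  have box: "in_box l u xs" using mult by (auto simp: kkt_NP_mult_def kkt_NP_def kkt_PP_def)
  have strict: "zs $ j \<noteq> 0 \<longleftrightarrow> j \<in> active l u xs" for j
  proof -
    have "min (ereal (xs $ j) - l $ j) (u $ j - ereal (xs $ j)) = 0 \<longleftrightarrow> j \<in> active l u xs"
      using box min_slack_eq_0_iff[of "l $ j" "xs $ j" "u $ j"] by (simp add: in_box_def active_def)
    then show ?thesis using A3[OF mult, of j] by blast
  qed
  have nonneg: "\<forall>p\<in>cone_NP c l u xs zs. 0 \<le> p \<bullet> (hess_phi f c l u \<omega> \<sigma> xs *v p)"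
    using xs sigma by (simp add: second_order_necessary_def)
  note conditions = second_order_conditions[OF mult A2_stationary[OF mult] strict sigma nonneg]
  have feasible: "\<sigma> > norm2 (transpose (Amat c xbar) ** Qmat l u \<omega> xbar ** Ymat f c l u \<omega> \<sigma> xbar) \<longrightarrow>
      c xbar = 0 \<and> kkt_NP f c l u \<omega> xbar zbar"
  proof
    assume "\<sigma> > norm2 (transpose (Amat c xbar) ** Qmat l u \<omega> xbar ** Ymat f c l u \<omega> \<sigma> xbar)"
    then have "c xbar = 0" by (rule kkt_PP_feasible[OF xbar bar_reg])
    then show "c xbar = 0 \<and> kkt_NP f c l u \<omega> xbar zbar"
      by (intro conjI kkt_PP_feasible_imp_kkt_NP[OF xbar bar_reg])
  qed
  have sufficient: "second_order_sufficient f c l u \<omega> xs ys zs \<longrightarrow>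
      ((\<forall>p\<in>cone_phi l u xs zs. p \<noteq> 0 \<longrightarrow> p \<bullet> (hess_phi f c l u \<omega> \<sigma> xs *v p) > 0)
        \<longleftrightarrow> \<sigma> > sigma_bar f c l u \<omega> xs ys)"
  proof
    assume "second_order_sufficient f c l u \<omega> xs ys zs"
    then have "\<forall>p\<in>cone_NP c l u xs zs. p \<noteq> 0 \<longrightarrow> 0 < p \<bullet> (hess_phi f c l u \<omega> \<sigma> xs *v p)"
      using sigma by (simp add: second_order_sufficient_def)
    then show "(\<forall>p\<in>cone_phi l u xs zs. p \<noteq> 0 \<longrightarrow> p \<bullet> (hess_phi f c l u \<omega> \<sigma> xs *v p) > 0)
        \<longleftrightarrow> \<sigma> > sigma_bar f c l u \<omega> xs ys"
      by (rule conditions(2))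
  qed
  show ?thesis by (rule conjI[OF feasible conjI[OF conditions(1) sufficient]])
qed

end
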